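(* Let $c\ge0$. The Laplace transform $L:L^2_c(0,\infty)\to H^2(\Pi_c)$ is an invertible bounded operator. In addition, for every $f\in L^2_c(0,\infty)$, $$\frac1{2\pi}\int_{-\infty}^\infty|Lf(s+it)|^2\,dt=\int_0^\infty e^{-2s\tau}|f(\tau)|^2\,d\tau\qquad\text{for all } s\ge c,$$ which implies that $\|Lf\|_{\Pi_c}=\sqrt{2\pi}\,\|f\|_{L^2_c(0,\infty)}$.
   Context: $\Pi_c=\{z\in\mathbb C:\mathrm{Re}\,z>c\}$. $H^2(\Pi_c)$ is the Hardy space of holomorphic functions $h$ on $\Pi_c$ with $\|h\|_{\Pi_c}^2:=\sup_{s>c}\int_{-\infty}^\infty|h(s+it)|^2\,dt<\infty$. $L^2_c(0,\infty)=\{f:e^{-ct}f(t)\in L^2(0,\infty)\}$ with norm $\|f\|_{L^2_c(0,\infty)}=\|e^{-ct}f\|_{L^2(0,\infty)}$. The Laplace transform is $Lf(z)=\int_0^\infty e^{-z\tau}f(\tau)\,d\tau$ for $z\in\Pi_c$; on the boundary line $s=c$, $t\mapsto Lf(c+it)$ is understood as the $L^2$ (Plancherel) transform $\int_0^\infty e^{-it\tau}e^{-c\tau}f(\tau)\,d\tau$. *)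

theory Defs
  imports "HOL-Complex_Analysis.Complex_Analysis"
begin

text \<open>
  Spaces of complex-valued functions are presented by representatives: \<open>members\<close> are the
  functions belonging to the space, \<open>same\<close> is the relation identifying two of them, and
  \<open>fnorm\<close> is the norm of the class represented by a function.
\<close>

record 'a fun_space =
  members :: "('a \<Rightarrow> complex) set"
  same :: "('a \<Rightarrow> complex) \<Rightarrow> ('a \<Rightarrow> complex) \<Rightarrow> bool"
  fnorm :: "('a \<Rightarrow> complex) \<Rightarrow> real"

definition bounded_operator ::
  "'a fun_space \<Rightarrow> 'b fun_space \<Rightarrow> (('a \<Rightarrow> complex) \<Rightarrow> 'b \<Rightarrow> complex) \<Rightarrow> bool" where
  "bounded_operator V W T \<longleftrightarrow>
     (\<forall>f\<in>members V. T f \<in> members W) \<and>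
     (\<forall>f\<in>members V. \<forall>g\<in>members V. same V f g \<longrightarrow> same W (T f) (T g)) \<and>
     (\<forall>f\<in>members V. \<forall>g\<in>members V. same W (T (\<lambda>x. f x + g x)) (\<lambda>y. T f y + T g y)) \<and>
     (\<forall>a. \<forall>f\<in>members V. same W (T (\<lambda>x. a * f x)) (\<lambda>y. a * T f y)) \<and>
     (\<exists>K. \<forall>f\<in>members V. fnorm W (T f) \<le> K * fnorm V f)"

definition invertible_bounded_operator ::
  "'a fun_space \<Rightarrow> 'b fun_space \<Rightarrow> (('a \<Rightarrow> complex) \<Rightarrow> 'b \<Rightarrow> complex) \<Rightarrow> bool" where
  "invertible_bounded_operator V W T \<longleftrightarrow>
     bounded_operator V W T \<and>
     (\<exists>S. bounded_operator W V S \<and>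
          (\<forall>f\<in>members V. same V (S (T f)) f) \<and>
          (\<forall>h\<in>members W. same W (T (S h)) h))"

definition L2_sqnorm :: "real set \<Rightarrow> (real \<Rightarrow> complex) \<Rightarrow> ennreal" where
  "L2_sqnorm A f = (\<integral>\<^sup>+ t. ennreal ((cmod (f t))\<^sup>2) \<partial>lebesgue_on A)"

definition L2 :: "real set \<Rightarrow> (real \<Rightarrow> complex) set" where
  "L2 A = {f. f \<in> borel_measurable (lebesgue_on A) \<and> L2_sqnorm A f < \<infinity>}"

definition L2_norm :: "real set \<Rightarrow> (real \<Rightarrow> complex) \<Rightarrow> real" where
  "L2_norm A f = sqrt (enn2real (L2_sqnorm A f))"

definition weighted :: "real \<Rightarrow> (real \<Rightarrow> complex) \<Rightarrow> real \<Rightarrow> complex" where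
  "weighted c f t = complex_of_real (exp (- c * t)) * f t"

definition L2_weighted :: "real \<Rightarrow> real fun_space" where
  "L2_weighted c =
     \<lparr> members = {f. weighted c f \<in> L2 {0<..}},
       same = (\<lambda>f g. AE t in lebesgue_on {0<..}. f t = g t),
       fnorm = (\<lambda>f. L2_norm {0<..} (weighted c f)) \<rparr>"

definition half_plane :: "real \<Rightarrow> complex set" where
  "half_plane c = {z. Re z > c}"

definition Hardy_sqnorm :: "real \<Rightarrow> (complex \<Rightarrow> complex) \<Rightarrow> ennreal" where
  "Hardy_sqnorm c h = (SUP s\<in>{c<..}. L2_sqnorm UNIV (\<lambda>t. h (Complex s t)))"

text \<open>
  Members of the Hardy space are total functions of which only the values on the half-plane
  matter.
\<close>

definition Hardy2 :: "real \<Rightarrow> complex fun_space" where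
  "Hardy2 c =
     \<lparr> members = {h. h holomorphic_on half_plane c \<and> Hardy_sqnorm c h < \<infinity>},
       same = (\<lambda>g h. \<forall>z\<in>half_plane c. g z = h z),
       fnorm = (\<lambda>h. sqrt (enn2real (Hardy_sqnorm c h))) \<rparr>"

definition laplace :: "(real \<Rightarrow> complex) \<Rightarrow> complex \<Rightarrow> complex" where
  "laplace f z = (LINT \<tau>|lebesgue_on {0<..}. exp (- z * complex_of_real \<tau>) * f \<tau>)"

text \<open>
  \<open>g\<close> represents the Plancherel transform of \<open>F \<in> L\<^sup>2(0,\<infinity>)\<close>: it is the limit in
  \<open>L\<^sup>2(\<real>)\<close> of the Fourier integrals of the truncations of \<open>F\<close> to \<open>(0,R)\<close>, which are
  integrable. Such a \<open>g\<close> is determined only up to null sets.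
\<close>

definition is_Plancherel_transform :: "(real \<Rightarrow> complex) \<Rightarrow> (real \<Rightarrow> complex) \<Rightarrow> bool" where
  "is_Plancherel_transform F g \<longleftrightarrow>
     g \<in> L2 UNIV \<and>
     ((\<lambda>R. L2_sqnorm UNIV
         (\<lambda>t. g t - (LINT \<tau>|lebesgue_on {0<..<R}.
                       exp (- \<i> * complex_of_real t * complex_of_real \<tau>) * F \<tau>)))
       \<longlongrightarrow> 0) at_top"

definition Plancherel_transform :: "(real \<Rightarrow> complex) \<Rightarrow> real \<Rightarrow> complex" where
  "Plancherel_transform F = (SOME g. is_Plancherel_transform F g)"

text \<open>
  The function \<open>t \<mapsto> Lf(s + it)\<close> for \<open>f \<in> L\<^sup>2\<^sub>c(0,\<infinity>)\<close> and \<open>s \<ge> c\<close>. On the line \<open>s = c\<close> the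
  Laplace integral need not converge absolutely.
\<close>

definition laplace_line :: "real \<Rightarrow> (real \<Rightarrow> complex) \<Rightarrow> real \<Rightarrow> real \<Rightarrow> complex" where
  "laplace_line c f s =
     (if s = c then Plancherel_transform (weighted c f) else (\<lambda>t. laplace f (Complex s t)))"

end

theory Submission
  imports Defs "HOL-Probability.Probability"
begin

text \<open>
  On a vertical line the Laplace transform is a Fourier transform:
  \<open>Lf(s + it)\<close> is the Fourier integral at \<open>t\<close> of \<open>\<tau> \<mapsto> exp (- s \<tau>) f(\<tau>)\<close>, extended by \<open>0\<close> to
  the left half-line. For \<open>s > c\<close> this function is in \<open>L\<^sup>1 \<inter> L\<^sup>2\<close>, and for \<open>s = c\<close> it is in \<open>L\<^sup>2\<close>.
  So the integral identity is Plancherel's theorem (\<open>plancherel_L1_L2\<close>, and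
  \<open>plancherel_L2_isometry\<close> for the line \<open>s = c\<close>), and letting \<open>s\<close> decrease to \<open>c\<close> under the
  integral turns it into the norm identity. In particular \<open>L\<close> is bounded and injective. It
  is linear, and differentiation under the integral sign shows that its values are holomorphic.

  Plancherel's identity is obtained by weighting \<open>|fourier F|\<^sup>2\<close> with a Gaussian of large width.
  The transform of the Gaussian is a normal density of small variance, and Fubini's theorem
  expresses the defect between the two sides as a mean of the squared distances between \<open>F\<close>
  and its translates (\<open>gauss_plancherel\<close>). The defect vanishes in the limit because translation is
  continuous in \<open>L\<^sup>2\<close> (\<open>energy_shift_tendsto\<close>). The extension to \<open>L\<^sup>2\<close> is by truncation and completeness
  (\<open>plancherel_L2_exists\<close>).

  For surjectivity (\<open>Paley_Wiener\<close>), fix a line \<open>Re z = s\<close> with \<open>s > c\<close> and let \<open>F\<close> be the inverse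
  transform of the restriction of \<open>h\<close> to it, cut off to the right half-line. The multiplication formula
  moves the transform onto the exponential \<open>exp (- z \<tau>)\<close>, where it becomes a Cauchy kernel. Hence
  \<open>LF(z)\<close> is the Cauchy integral of \<open>h\<close> over that line, which by \<open>half_plane_Cauchy_formula\<close> is \<open>h(z)\<close>
  for \<open>Re z > s\<close>. That formula is where membership in the Hardy space enters: a
  square-integrability bound that is uniform over all lines makes the other sides of large rectangles
  negligible. By injectivity \<open>F\<close> is the same function for all \<open>s\<close>, and the bound on \<open>exp (- s \<tau>) F(\<tau>)\<close>, which
  is uniform in \<open>s > c\<close>, passes to \<open>s = c\<close>.
\<close>

section \<open>The squared L2 norm on the real line\<close>

text \<open>
  The quantity \<open>L2_sqnorm UNIV\<close> of a Borel function, taken with respect to Borel-Lebesgue measure,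
  so that Fubini's theorem applies on products of that measure with itself.
\<close>

definition energy :: "(real \<Rightarrow> complex) \<Rightarrow> ennreal" where
  "energy F = (\<integral>\<^sup>+ x. ennreal ((cmod (F x))\<^sup>2) \<partial>lborel)"

text \<open>
  The weighted triangle inequality: the factor in front of \<open>|a|\<^sup>2\<close> can be made as close to \<open>1\<close> as
  desired, which is what turns it into continuity of the norm in \<open>energy_limit\<close>.
\<close>

lemma cmod_add_square_le:
  fixes a b :: complex and d :: real
  assumes "d > 0"
  shows "(cmod (a + b))\<^sup>2 \<le> (1 + d) * (cmod a)\<^sup>2 + (1 + 1 / d) * (cmod b)\<^sup>2"
proof -
  have "(cmod (a + b))\<^sup>2 \<le> (cmod a + cmod b)\<^sup>2"
    by (intro power_mono norm_triangle_ineq) auto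
  also have "\<dots> = (1 + d) * (cmod a)\<^sup>2 + (1 + 1 / d) * (cmod b)\<^sup>2 - (d * cmod a - cmod b)\<^sup>2 / d"
    using assms by (simp add: field_simps power2_eq_square)
  also have "\<dots> \<le> (1 + d) * (cmod a)\<^sup>2 + (1 + 1 / d) * (cmod b)\<^sup>2"
    using assms by simp
  finally show ?thesis .
qed

lemma energy_add_le:
  assumes [measurable]: "F \<in> borel_measurable borel" "G \<in> borel_measurable borel" and d: "d > 0"
  shows "energy (\<lambda>x. F x + G x) \<le> ennreal (1 + d) * energy F + ennreal (1 + 1 / d) * energy G"
proof -
  have "energy (\<lambda>x. F x + G x)
      \<le> (\<integral>\<^sup>+ x. ennreal (1 + d) * ennreal ((cmod (F x))\<^sup>2)
               + ennreal (1 + 1 / d) * ennreal ((cmod (G x))\<^sup>2) \<partial>lborel)"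
    unfolding energy_def using d cmod_add_square_le[OF d]
    by (intro nn_integral_mono)
       (auto simp flip: ennreal_mult'' ennreal_plus intro!: ennreal_leI)
  also have "\<dots> = ennreal (1 + d) * energy F + ennreal (1 + 1 / d) * energy G"
    unfolding energy_def by (simp add: nn_integral_add nn_integral_cmult)
  finally show ?thesis .
qed

lemma energy_uminus: "energy (\<lambda>x. - F x) = energy F"
  by (simp add: energy_def)

lemma energy_minus_commute: "energy (\<lambda>x. F x - G x) = energy (\<lambda>x. G x - F x)"
  by (simp add: energy_def norm_minus_commute)

lemma energy_diff_finite:
  assumes "F \<in> borel_measurable borel" "G \<in> borel_measurable borel" "energy F < \<infinity>" "energy G < \<infinity>"
  shows "energy (\<lambda>x. F x - G x) < \<infinity>"
proof -
  have "energy (\<lambda>x. F x + - G x) \<le> ennreal (1 + 1) * energy F + ennreal (1 + 1 / 1) * energy (\<lambda>x. - G x)"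
    using assms by (intro energy_add_le) auto
  also have "\<dots> < \<infinity>"
    using assms by (auto simp: energy_uminus ennreal_mult_less_top)
  finally show ?thesis by simp
qed

lemma ennreal_le_if_le_scaled:
  fixes x y :: ennreal
  assumes "\<And>d. d > 0 \<Longrightarrow> x \<le> ennreal (1 + d) * y"
  shows "x \<le> y"
proof (rule tendsto_lowerbound)
  have "((\<lambda>d. ennreal (1 + d)) \<longlongrightarrow> ennreal (1 + 0)) (at_right 0)"
    by (intro tendsto_intros)
  then show "((\<lambda>d. ennreal (1 + d) * y) \<longlongrightarrow> y) (at_right 0)"
    using tendsto_mult_ennreal[of "\<lambda>d. ennreal (1 + d)" 1 "at_right 0" "\<lambda>_. y" y] by auto
  show "\<forall>\<^sub>F d in at_right 0. x \<le> ennreal (1 + d) * y"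
    using assms by (auto simp: eventually_at_filter)
qed auto

lemma energy_limit:
  assumes [measurable]: "\<And>n. F n \<in> borel_measurable borel" "G \<in> borel_measurable borel"
    and lim: "(\<lambda>n. energy (\<lambda>x. G x - F n x)) \<longlonglongrightarrow> 0"
    and L: "(\<lambda>n. energy (F n)) \<longlonglongrightarrow> L"
  shows "energy G = L"
proof (rule antisym)
  show "energy G \<le> L"
  proof (rule ennreal_le_if_le_scaled)
    fix d :: real assume d: "d > 0"
    have "(\<lambda>n. ennreal (1 + d) * energy (F n) + ennreal (1 + 1 / d) * energy (\<lambda>x. G x - F n x))
        \<longlonglongrightarrow> ennreal (1 + d) * L + ennreal (1 + 1 / d) * 0"
      by (intro tendsto_add ennreal_tendsto_cmult L lim) auto
    moreover have "energy G \<le> ennreal (1 + d) * energy (F n) + ennreal (1 + 1 / d) * energy (\<lambda>x. G x - F n x)" for n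
      using energy_add_le[of "F n" "\<lambda>x. G x - F n x", OF _ _ d] by simp
    ultimately show "energy G \<le> ennreal (1 + d) * L"
      by (auto intro: LIMSEQ_le_const)
  qed
  show "L \<le> energy G"
  proof (rule ennreal_le_if_le_scaled)
    fix d :: real assume d: "d > 0"
    have "(\<lambda>n. ennreal (1 + d) * energy G + ennreal (1 + 1 / d) * energy (\<lambda>x. G x - F n x))
        \<longlonglongrightarrow> ennreal (1 + d) * energy G + ennreal (1 + 1 / d) * 0"
      by (intro tendsto_add ennreal_tendsto_cmult tendsto_const lim) auto
    moreover have "energy (F n) \<le> ennreal (1 + d) * energy G + ennreal (1 + 1 / d) * energy (\<lambda>x. G x - F n x)" for n
      using energy_add_le[of G "\<lambda>x. F n x - G x", OF _ _ d] energy_minus_commute[of "F n" G] by simp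
    ultimately show "L \<le> ennreal (1 + d) * energy G"
      using L by (auto intro: LIMSEQ_le)
  qed
qed

section \<open>Continuity of translation\<close>

lemma nn_integral_lborel_shift:
  fixes f :: "real \<Rightarrow> ennreal"
  assumes [measurable]: "f \<in> borel_measurable borel"
  shows "(\<integral>\<^sup>+ x. f (x + u) \<partial>lborel) = (\<integral>\<^sup>+ x. f x \<partial>lborel)"
  using nn_integral_real_affine[of f 1 u] by (simp add: add.commute)

lemma L1_shift_le:
  fixes f g :: "real \<Rightarrow> complex"
  assumes [measurable]: "f \<in> borel_measurable borel" "g \<in> borel_measurable borel"
  shows "(\<integral>\<^sup>+ x. norm (f (x + u) - f x) \<partial>lborel)
     \<le> (\<integral>\<^sup>+ x. norm (g (x + u) - g x) \<partial>lborel) + 2 * (\<integral>\<^sup>+ x. norm (f x - g x) \<partial>lborel)"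
proof -
  have "(\<integral>\<^sup>+ x. norm (f (x + u) - f x) \<partial>lborel)
     \<le> (\<integral>\<^sup>+ x. ennreal (norm (g (x + u) - g x)) + (ennreal (norm (f (x + u) - g (x + u)))
          + ennreal (norm (f x - g x))) \<partial>lborel)"
  proof (intro nn_integral_mono)
    fix x
    have "norm (f (x + u) - f x) \<le> norm (g (x + u) - g x) + (norm (f (x + u) - g (x + u)) + norm (f x - g x))"
      by norm
    then show "ennreal (norm (f (x + u) - f x)) \<le> ennreal (norm (g (x + u) - g x)) + (ennreal (norm (f (x + u) - g (x + u)))
          + ennreal (norm (f x - g x)))"
      by (simp flip: ennreal_plus)
  qed
  also have "\<dots> = (\<integral>\<^sup>+ x. norm (g (x + u) - g x) \<partial>lborel)
      + ((\<integral>\<^sup>+ x. norm (f (x + u) - g (x + u)) \<partial>lborel) + (\<integral>\<^sup>+ x. norm (f x - g x) \<partial>lborel))"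
    by (simp add: nn_integral_add)
  also have "(\<integral>\<^sup>+ x. norm (f (x + u) - g (x + u)) \<partial>lborel) = (\<integral>\<^sup>+ x. norm (f x - g x) \<partial>lborel)"
    using nn_integral_lborel_shift[of "\<lambda>x. norm (f x - g x)"] by simp
  finally show ?thesis by (simp add: mult_2)
qed

text \<open>
  Translation moves both \<open>f\<close> and an approximation \<open>g\<close> by the same amount, so the
  functions on which it is continuous in \<open>L\<^sup>1\<close> form a closed set. It therefore suffices to treat
  indicators of open sets, from which all integrable functions are obtained by approximation.
\<close>

lemma L1_shift_closed:
  fixes f :: "real \<Rightarrow> complex"
  assumes [measurable]: "f \<in> borel_measurable borel"
    and ap: "\<And>e. 0 < (e :: real) \<Longrightarrow> \<exists>g \<in> borel_measurable borel. (\<integral>\<^sup>+ x. norm (f x - g x) \<partial>lborel) \<le> ennreal e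
               \<and> (\<lambda>n. \<integral>\<^sup>+ x. norm (g (x + u n) - g x) \<partial>lborel) \<longlonglongrightarrow> 0"
  shows "(\<lambda>n. \<integral>\<^sup>+ x. norm (f (x + u n) - f x) \<partial>lborel) \<longlonglongrightarrow> 0"
proof (rule order_tendstoI)
  fix a :: ennreal assume "0 < a"
  then obtain b where b: "0 < b" "b < a" using dense by blast
  then obtain e :: real where e: "e > 0" "b = ennreal e"
    by (cases b) auto
  obtain g where [measurable]: "g \<in> borel_measurable borel"
    and g: "(\<integral>\<^sup>+ x. norm (f x - g x) \<partial>lborel) \<le> ennreal (e / 4)"
      "(\<lambda>n. \<integral>\<^sup>+ x. norm (g (x + u n) - g x) \<partial>lborel) \<longlonglongrightarrow> 0"
    using ap[of "e / 4"] e by auto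
  have "\<forall>\<^sub>F n in sequentially. (\<integral>\<^sup>+ x. norm (g (x + u n) - g x) \<partial>lborel) < ennreal (e / 2)"
    using g(2) e by (intro order_tendstoD) auto
  then show "\<forall>\<^sub>F n in sequentially. (\<integral>\<^sup>+ x. norm (f (x + u n) - f x) \<partial>lborel) < a"
  proof eventually_elim
    case (elim n)
    have "(\<integral>\<^sup>+ x. norm (f (x + u n) - f x) \<partial>lborel) \<le> ennreal (e / 2) + 2 * ennreal (e / 4)"
      using elim g(1) L1_shift_le[of f g "u n"]
      by (intro order_trans[OF L1_shift_le[of f g "u n"]] add_mono mult_left_mono) auto
    also have "\<dots> = ennreal (e / 2) + ennreal 2 * ennreal (e / 4)"
      by simp
    also have "\<dots> = ennreal e"
      using e by (subst ennreal_mult[symmetric]) (auto simp del: ennreal_numeral simp flip: ennreal_plus)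
    finally show ?case using b e by auto
  qed
qed auto

text \<open>
  A point of an open set stays in the set under a small shift, so dominated convergence, with
  the indicator itself as majorant, controls the mass that leaves \<open>U\<close>. The mass that enters
  \<open>U\<close> is the mass that leaves it under the opposite shift.
\<close>

lemma L1_shift_open_indicator:
  fixes u :: "nat \<Rightarrow> real"
  assumes U: "open U" "emeasure lborel U < \<infinity>" and u: "u \<longlonglongrightarrow> 0"
  shows "(\<lambda>n. \<integral>\<^sup>+ x. norm (indicator U (x + u n) - indicator U x :: complex) \<partial>lborel) \<longlonglongrightarrow> 0"
proof -
  have [measurable]: "U \<in> sets borel" using U by auto
  define k :: "real \<Rightarrow> real \<Rightarrow> ennreal" where "k v x = indicator U x * indicator (- U) (x + v)" for v x
  have [measurable]: "k v \<in> borel_measurable borel" for v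
    unfolding k_def by measurable
  have lim: "(\<lambda>n. \<integral>\<^sup>+ x. k (v n) x \<partial>lborel) \<longlonglongrightarrow> 0" if v: "v \<longlonglongrightarrow> 0" for v
  proof -
    have "(\<lambda>n. \<integral>\<^sup>+ x. k (v n) x \<partial>lborel) \<longlonglongrightarrow> (\<integral>\<^sup>+ x. 0 \<partial>(lborel :: real measure))"
    proof (rule nn_integral_dominated_convergence[where w = "indicator U"])
      show "(\<integral>\<^sup>+ x. indicator U x \<partial>lborel) < \<infinity>" using U by simp
      show "AE x in lborel. (\<lambda>n. k (v n) x) \<longlonglongrightarrow> 0"
      proof (rule AE_I2)
        fix x :: real
        show "(\<lambda>n. k (v n) x) \<longlonglongrightarrow> 0"
        proof (cases "x \<in> U")
          case True
          have "(\<lambda>n. x + v n) \<longlonglongrightarrow> x + 0" by (intro tendsto_intros v)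
          then have "\<forall>\<^sub>F n in sequentially. x + v n \<in> U"
            using True U by (intro topological_tendstoD) auto
          then have "\<forall>\<^sub>F n in sequentially. k (v n) x = 0"
            by eventually_elim (simp add: k_def)
          then show ?thesis by (rule tendsto_eventually)
        qed (simp add: k_def)
      qed
    qed (auto simp: k_def indicator_def)
    then show ?thesis by simp
  qed
  have eq: "(\<integral>\<^sup>+ x. norm (indicator U (x + v) - indicator U x :: complex) \<partial>lborel)
      = (\<integral>\<^sup>+ x. k v x \<partial>lborel) + (\<integral>\<^sup>+ x. k (- v) x \<partial>lborel)" for v
  proof -
    have "(\<integral>\<^sup>+ x. norm (indicator U (x + v) - indicator U x :: complex) \<partial>lborel)
        = (\<integral>\<^sup>+ x. k v x + k (- v) (x + v) \<partial>lborel)"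
      by (intro nn_integral_cong) (auto simp: k_def indicator_def)
    also have "\<dots> = (\<integral>\<^sup>+ x. k v x \<partial>lborel) + (\<integral>\<^sup>+ x. k (- v) (x + v) \<partial>lborel)"
      by (intro nn_integral_add) auto
    finally show ?thesis using nn_integral_lborel_shift[of "k (- v)" v] by simp
  qed
  show ?thesis
    unfolding eq using tendsto_add[OF lim[OF u] lim[of "\<lambda>n. - u n"]] tendsto_minus[OF u] by simp
qed

lemma L1_shift_indicator:
  fixes u :: "nat \<Rightarrow> real"
  assumes A[measurable]: "A \<in> sets borel" and fin: "emeasure lborel A < \<infinity>" and u: "u \<longlonglongrightarrow> 0"
  shows "(\<lambda>n. \<integral>\<^sup>+ x. norm (indicator A (x + u n) - indicator A x :: complex) \<partial>lborel) \<longlonglongrightarrow> 0"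
proof (rule L1_shift_closed[where f = "indicator A"])
print_state  fix e :: real assume e: "e > 0"
  have "A \<in> sets lebesgue" by auto
  from sets_lebesgue_outer_open[OF this e] obtain U where
    U: "open U" "A \<subseteq> U" "U - A \<in> lmeasurable" "emeasure lebesgue (U - A) < ennreal e" by metis
  have [measurable]: "U \<in> sets borel" using U by auto
  have eU: "emeasure lborel (U - A) < ennreal e"
    using U by simp
  have "emeasure lborel U = emeasure lborel (A \<union> (U - A))" using U by (simp add: Un_absorb1)
  also have "\<dots> \<le> emeasure lborel A + emeasure lborel (U - A)"
    by (intro emeasure_subadditive) auto
  also have "\<dots> < \<infinity>" using fin eU by (auto intro: less_trans)
  finally have finU: "emeasure lborel U < \<infinity>" .
  have "(\<integral>\<^sup>+ x. norm (indicator A x - indicator U x :: complex) \<partial>lborel) = (\<integral>\<^sup>+ x. indicator (U - A) x \<partial>lborel)"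
    using U by (intro nn_integral_cong) (auto simp: indicator_def)
  also have "\<dots> \<le> e" using eU by auto
  finally show "\<exists>g \<in> borel_measurable borel. (\<integral>\<^sup>+ x. norm (indicator A x - g x :: complex) \<partial>lborel) \<le> ennreal e
               \<and> (\<lambda>n. \<integral>\<^sup>+ x. norm (g (x + u n) - g x) \<partial>lborel) \<longlonglongrightarrow> 0"
    using L1_shift_open_indicator[OF U(1) finU u] by (intro bexI[of _ "indicator U"]) auto
qed auto

lemma L1_shift_tendsto:
  fixes f :: "real \<Rightarrow> complex" and u :: "nat \<Rightarrow> real"
  assumes f: "integrable lborel f" and u: "u \<longlonglongrightarrow> 0"
  shows "(\<lambda>n. \<integral>\<^sup>+ x. norm (f (x + u n) - f x) \<partial>lborel) \<longlonglongrightarrow> 0"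
  using f
proof (induction rule: integrable_induct)
  case (base A c)
  then have [measurable]: "A \<in> sets borel" by simp
  have "(\<integral>\<^sup>+ x. norm (indicat_real A (x + v) *\<^sub>R c - indicat_real A x *\<^sub>R c) \<partial>lborel)
      = norm c * (\<integral>\<^sup>+ x. norm (indicator A (x + v) - indicator A x :: complex) \<partial>lborel)" for v
    by (subst nn_integral_cmult[symmetric])
       (auto intro!: nn_integral_cong simp: indicator_def)
  moreover have "(\<lambda>n. norm c * (\<integral>\<^sup>+ x. norm (indicator A (x + u n) - indicator A x :: complex) \<partial>lborel)) \<longlonglongrightarrow> ennreal (norm c) * 0"
    using base by (intro ennreal_tendsto_cmult L1_shift_indicator u) auto
  ultimately show ?case by simp
next
  case (add f g)
  then have [measurable]: "f \<in> borel_measurable borel" "g \<in> borel_measurable borel" by auto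
  have "(\<lambda>n. (\<integral>\<^sup>+ x. norm (f (x + u n) - f x) \<partial>lborel) + (\<integral>\<^sup>+ x. norm (g (x + u n) - g x) \<partial>lborel)) \<longlonglongrightarrow> 0 + 0"
    by (intro tendsto_add add)
  then have lim: "(\<lambda>n. (\<integral>\<^sup>+ x. norm (f (x + u n) - f x) \<partial>lborel) + (\<integral>\<^sup>+ x. norm (g (x + u n) - g x) \<partial>lborel)) \<longlonglongrightarrow> 0"
    by simp
  have le: "(\<integral>\<^sup>+ x. norm (f (x + u n) + g (x + u n) - (f x + g x)) \<partial>lborel)
      \<le> (\<integral>\<^sup>+ x. norm (f (x + u n) - f x) \<partial>lborel) + (\<integral>\<^sup>+ x. norm (g (x + u n) - g x) \<partial>lborel)" for n
  proof -
    have "(\<integral>\<^sup>+ x. norm (f (x + u n) + g (x + u n) - (f x + g x)) \<partial>lborel)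
      \<le> (\<integral>\<^sup>+ x. ennreal (norm (f (x + u n) - f x)) + ennreal (norm (g (x + u n) - g x)) \<partial>lborel)"
      by (intro nn_integral_mono) (auto simp flip: ennreal_plus intro!: ennreal_leI norm_diff_triangle_ineq)
    then show ?thesis by (simp add: nn_integral_add)
  qed
  show ?case
    by (rule tendsto_sandwich[OF _ _ tendsto_const lim]) (auto simp: le)
next
  case (lim f s)
  then have [measurable]: "f \<in> borel_measurable borel" "\<And>i. s i \<in> borel_measurable borel" by auto
  have "(\<lambda>i. \<integral>\<^sup>+ x. norm (f x - s i x) \<partial>lborel) \<longlonglongrightarrow> (\<integral>\<^sup>+ x. 0 \<partial>(lborel :: real measure))"
  proof (rule nn_integral_dominated_convergence[where w = "\<lambda>x. ennreal (3 * norm (f x))"])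
    show "AE x in lborel. ennreal (norm (f x - s i x)) \<le> ennreal (3 * norm (f x))" for i
    proof (rule AE_I2)
      fix x
      have "norm (f x - s i x) \<le> norm (f x) + norm (s i x)" by norm
      then show "ennreal (norm (f x - s i x)) \<le> ennreal (3 * norm (f x))"
        using lim.hyps(3)[of x i] by (intro ennreal_leI) auto
    qed
    have "integrable lborel (\<lambda>x. 3 * norm (f x))" using lim by auto
    then show "(\<integral>\<^sup>+ x. ennreal (3 * norm (f x)) \<partial>lborel) < \<infinity>"
      by (subst nn_integral_eq_integral) auto
    show "AE x in lborel. (\<lambda>i. ennreal (norm (f x - s i x))) \<longlonglongrightarrow> 0"
    proof (rule AE_I2)
      fix x
      have "(\<lambda>i. norm (f x - s i x)) \<longlonglongrightarrow> norm (f x - f x)"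
        using lim.hyps(2)[of x] by (intro tendsto_intros) auto
      then show "(\<lambda>i. ennreal (norm (f x - s i x))) \<longlonglongrightarrow> 0"
        by (auto dest: tendsto_ennrealI)
    qed
  qed auto
  then have 0: "(\<lambda>i. \<integral>\<^sup>+ x. norm (f x - s i x) \<partial>lborel) \<longlonglongrightarrow> 0" by simp
  show ?case
  proof (rule L1_shift_closed)
    fix e :: real assume "e > 0"
    then have "\<forall>\<^sub>F i in sequentially. (\<integral>\<^sup>+ x. norm (f x - s i x) \<partial>lborel) < ennreal e"
      using 0 by (intro order_tendstoD) auto
    then obtain i where "(\<integral>\<^sup>+ x. norm (f x - s i x) \<partial>lborel) < ennreal e"
      by (auto simp: eventually_sequentially)
    then show "\<exists>g \<in> borel_measurable borel. (\<integral>\<^sup>+ x. norm (f x - g x) \<partial>lborel) \<le> ennreal e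
               \<and> (\<lambda>n. \<integral>\<^sup>+ x. norm (g (x + u n) - g x) \<partial>lborel) \<longlonglongrightarrow> 0"
      using lim.IH[of i] by (intro bexI[of _ "s i"]) auto
  qed auto
qed

text \<open>
  The map \<open>a \<mapsto> |a| a\<close> is strongly monotone. Since it takes \<open>L\<^sup>2\<close> to \<open>L\<^sup>1\<close>, this inequality carries
  continuity of translation from \<open>L\<^sup>1\<close> over to \<open>L\<^sup>2\<close>.
\<close>

lemma cmod_diff_square_le:
  fixes a b :: complex
  shows "(cmod (a - b))\<^sup>2 \<le> 2 * cmod (cmod a *\<^sub>R a - cmod b *\<^sub>R b)"
proof (cases "a = b")
  case False
  define x y p where "x = cmod a" and "y = cmod b" and "p = a \<bullet> b"
  have nn: "x \<ge> 0" "y \<ge> 0" by (auto simp: x_def y_def)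
  have sq: "(cmod (a - b))\<^sup>2 = x\<^sup>2 + y\<^sup>2 - 2 * p"
    by (simp add: x_def y_def p_def dot_norm_neg field_simps)
  have aa: "a \<bullet> a = x\<^sup>2" "b \<bullet> b = y\<^sup>2" by (simp_all add: x_def y_def power2_norm_eq_inner)
  have "cmod (a - b) ^ 3 \<le> (cmod (a - b))\<^sup>2 * (x + y)"
    unfolding power3_eq_cube power2_eq_square x_def y_def
    by (intro mult_left_mono norm_triangle_ineq4) auto
  also have "\<dots> \<le> 2 * ((x *\<^sub>R a - y *\<^sub>R b) \<bullet> (a - b))"
  proof -
    have "2 * ((x *\<^sub>R a - y *\<^sub>R b) \<bullet> (a - b)) - (cmod (a - b))\<^sup>2 * (x + y) = (x + y) * (x - y)\<^sup>2"
      unfolding sq by (simp add: inner_diff_left inner_diff_right aa inner_commute[of b a] flip: p_def)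
        (simp add: algebra_simps power2_eq_square)
    moreover have "(x + y) * (x - y)\<^sup>2 \<ge> 0" using nn by simp
    ultimately show ?thesis by linarith
  qed
  also have "\<dots> \<le> 2 * (cmod (x *\<^sub>R a - y *\<^sub>R b) * cmod (a - b))"
    using norm_cauchy_schwarz by (intro mult_left_mono) auto
  finally have "cmod (a - b) * (cmod (a - b))\<^sup>2 \<le> cmod (a - b) * (2 * cmod (x *\<^sub>R a - y *\<^sub>R b))"
    by (simp add: power3_eq_cube power2_eq_square mult_ac)
  then show ?thesis using False by (simp add: x_def y_def)
qed simp

lemma energy_shift_tendsto:
  fixes u :: "nat \<Rightarrow> real"
  assumes [measurable]: "F \<in> borel_measurable borel" and fin: "energy F < \<infinity>" and u: "u \<longlonglongrightarrow> 0"
  shows "(\<lambda>n. energy (\<lambda>x. F (x + u n) - F x)) \<longlonglongrightarrow> 0"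
proof -
  define G where "G x = cmod (F x) *\<^sub>R F x" for x
  have [measurable]: "G \<in> borel_measurable borel" unfolding G_def by measurable
  have "integrable lborel G"
    unfolding integrable_iff_bounded using fin
    by (auto simp: G_def energy_def power2_eq_square)
  then have "(\<lambda>n. 2 * (\<integral>\<^sup>+ x. norm (G (x + u n) - G x) \<partial>lborel)) \<longlonglongrightarrow> 2 * 0"
    by (intro ennreal_tendsto_cmult L1_shift_tendsto u) auto
  then have lim: "(\<lambda>n. 2 * (\<integral>\<^sup>+ x. norm (G (x + u n) - G x) \<partial>lborel)) \<longlonglongrightarrow> 0" by simp
  have le: "energy (\<lambda>x. F (x + v) - F x) \<le> 2 * (\<integral>\<^sup>+ x. norm (G (x + v) - G x) \<partial>lborel)" for v
  proof -
    have "energy (\<lambda>x. F (x + v) - F x) \<le> (\<integral>\<^sup>+ x. ennreal (2 * norm (G (x + v) - G x)) \<partial>lborel)"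
      unfolding energy_def G_def using cmod_diff_square_le by (intro nn_integral_mono ennreal_leI) auto
    also have "\<dots> = 2 * (\<integral>\<^sup>+ x. norm (G (x + v) - G x) \<partial>lborel)"
      by (simp add: ennreal_mult'' nn_integral_cmult)
    finally show ?thesis .
  qed
  show ?thesis
    by (rule tendsto_sandwich[OF _ _ tendsto_const lim]) (auto simp: le)
qed

section \<open>The Fourier integral\<close>

definition fourier :: "(real \<Rightarrow> complex) \<Rightarrow> real \<Rightarrow> complex" where
  "fourier F t = (LINT x|lborel. exp (- \<i> * complex_of_real t * complex_of_real x) * F x)"

lemma cmod_fourier_kernel [simp]: "cmod (exp (- (\<i> * complex_of_real t * complex_of_real x))) = 1"
  by (simp add: norm_exp_eq_Re)

lemma integrable_fourier_kernel:
  assumes "integrable lborel F"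
  shows "integrable lborel (\<lambda>x. exp (- \<i> * complex_of_real t * complex_of_real x) * F x)"
proof (rule Bochner_Integration.integrable_bound[OF assms])
  have [measurable]: "F \<in> borel_measurable borel" using assms by auto
  show "(\<lambda>x. exp (- \<i> * complex_of_real t * complex_of_real x) * F x) \<in> borel_measurable lborel"
    by measurable
qed (auto simp: norm_mult)

lemma borel_measurable_fourier [measurable]:
  assumes [measurable]: "F \<in> borel_measurable borel"
  shows "fourier F \<in> borel_measurable borel"
  unfolding fourier_def by measurable

lemma cmod_fourier_le: "cmod (fourier F t) \<le> (LINT x|lborel. cmod (F x))"
  unfolding fourier_def
  by (rule order_trans[OF integral_norm_bound]) (simp add: norm_mult)

lemma borel_measurable_cnj [measurable]: "cnj \<in> borel_measurable borel"
  by (intro borel_measurable_continuous_onI continuous_intros)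

lemma integrable_pair_mult:
  fixes F G :: "real \<Rightarrow> complex"
  assumes F: "integrable lborel F" and G: "integrable lborel G"
  shows "integrable (lborel \<Otimes>\<^sub>M lborel) (\<lambda>(x, y). F x * G y)"
proof (rule lborel_pair.Fubini_integrable)
  have [measurable]: "F \<in> borel_measurable borel" "G \<in> borel_measurable borel"
    using F G by auto
  show "(\<lambda>(x, y). F x * G y) \<in> borel_measurable (lborel \<Otimes>\<^sub>M lborel)"
    by measurable
  show "integrable lborel (\<lambda>x. LINT y|lborel. cmod (case (x, y) of (x, y) \<Rightarrow> F x * G y))"
    using F by (simp add: norm_mult)
  show "AE x in lborel. integrable lborel (\<lambda>y. case (x, y) of (x, y) \<Rightarrow> F x * G y)"
    using G by simp
qed

lemma fourier_multiplication_formula: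
  assumes F: "integrable lborel F" and G: "integrable lborel G"
  shows "(LINT t|lborel. fourier F t * G t) = (LINT x|lborel. F x * fourier G x)"
proof -
  have [measurable]: "F \<in> borel_measurable borel" "G \<in> borel_measurable borel"
    using F G by auto
  define h where "h x t = exp (- \<i> * complex_of_real t * complex_of_real x) * F x * G t" for x t
  have "integrable (lborel \<Otimes>\<^sub>M lborel) (case_prod h)"
  proof (rule Bochner_Integration.integrable_bound[OF integrable_pair_mult[OF F G]])
    show "case_prod h \<in> borel_measurable (lborel \<Otimes>\<^sub>M lborel)"
      unfolding h_def by measurable
  qed (auto simp: h_def norm_mult)
  from lborel_pair.Fubini_integral[OF this]
  have "(LINT t|lborel. LINT x|lborel. h x t) = (LINT x|lborel. LINT t|lborel. h x t)" .
  moreover have "(LINT x|lborel. h x t) = fourier F t * G t" for t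
    by (simp add: h_def fourier_def)
  moreover have "(LINT t|lborel. h x t) = F x * fourier G x" for x
  proof -
    have "(LINT t|lborel. h x t) = (LINT t|lborel. F x * (exp (- \<i> * complex_of_real x * complex_of_real t) * G t))"
      unfolding h_def by (intro Bochner_Integration.integral_cong refl) (simp add: mult_ac)
    then show ?thesis unfolding fourier_def by (simp only: integral_mult_right_zero)
  qed
  ultimately show ?thesis by simp
qed

section \<open>Plancherel's identity for integrable functions\<close>

text \<open>
  A rescaling of the characteristic function of the standard normal distribution.
\<close>

lemma fourier_gauss:
  assumes d: "d > 0"
  shows "fourier (\<lambda>t. complex_of_real (exp (- (d * t)\<^sup>2 / 2))) u
       = complex_of_real (2 * pi * normal_density 0 d u)"
proof -
  define v where "v = - u / d"
  have "complex_of_real (exp (- (v\<^sup>2) / 2)) = char std_normal_distribution v"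
    by (simp add: char_std_normal_distribution)
  also have "\<dots> = (LINT x|lborel. std_normal_density x *\<^sub>R iexp (v * x))"
    unfolding char_def by (subst integral_density) (auto simp: normal_density_nonneg)
  also have "\<dots> = d * (LINT t|lborel. std_normal_density (d * t) *\<^sub>R iexp (v * (d * t)))"
    using d by (subst lborel_integral_real_affine[where c = d and t = 0]) (auto simp: scaleR_conv_of_real)
  also have "(LINT t|lborel. std_normal_density (d * t) *\<^sub>R iexp (v * (d * t)))
      = (LINT t|lborel. (1 / sqrt (2 * pi)) * (exp (- \<i> * u * t) * complex_of_real (exp (- (d * t)\<^sup>2 / 2))))"
  proof (intro Bochner_Integration.integral_cong refl)
    fix t :: real
    have "v * (d * t) = - u * t" using d by (simp add: v_def)
    then show "std_normal_density (d * t) *\<^sub>R iexp (v * (d * t))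
       = (1 / sqrt (2 * pi)) * (exp (- \<i> * u * t) * complex_of_real (exp (- (d * t)\<^sup>2 / 2)))"
      by (simp only: std_normal_density_def scaleR_conv_of_real) (simp add: mult_ac)
  qed
  also have "\<dots> = (1 / sqrt (2 * pi)) * fourier (\<lambda>t. complex_of_real (exp (- (d * t)\<^sup>2 / 2))) u"
    unfolding fourier_def by (rule integral_mult_right_zero)
  finally have "fourier (\<lambda>t. complex_of_real (exp (- (d * t)\<^sup>2 / 2))) u
      = complex_of_real (sqrt (2 * pi) / d * exp (- (v\<^sup>2) / 2))"
    using d by (simp add: field_simps)
  also have "sqrt (2 * pi) / d * exp (- (v\<^sup>2) / 2) = 2 * pi * normal_density 0 d u"
  proof -
    have "sqrt (2 * pi) / d = 2 * pi / (sqrt (2 * pi) * d)"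
      by (simp add: real_div_sqrt flip: divide_divide_eq_left)
    moreover have "normal_density 0 d u = 1 / (sqrt (2 * pi) * d) * exp (- (v\<^sup>2) / 2)"
      using d by (simp add: normal_density_def v_def real_sqrt_mult power_divide)
    ultimately show ?thesis by simp
  qed
  finally show ?thesis .
qed

lemma integrable_gauss:
  assumes "(d :: real) > 0"
  shows "integrable lborel (\<lambda>t. exp (- (d * t)\<^sup>2 / 2))"
proof -
  have "integrable lborel (\<lambda>x. sqrt (2 * pi) * std_normal_density x)"
    by auto
  then have "integrable lborel (\<lambda>x::real. exp (- x\<^sup>2 / 2))"
    by (simp add: std_normal_density_def)
  from lborel_integrable_real_affine[OF this, of d 0] assms show ?thesis by simp
qed

lemma fourier_modulation:
  "fourier (\<lambda>t. exp (\<i> * of_real t * of_real x) * G t) y = fourier G (y - x)"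
  unfolding fourier_def
  by (intro Bochner_Integration.integral_cong refl)
     (simp add: ring_distribs exp_diff exp_minus field_simps)

text \<open>
  Two applications of the multiplication formula: the first moves one transform off
  \<open>|fourier F|\<^sup>2\<close>, and the second, with the modulated Gaussian in place of \<open>G\<close>, removes the other. What is left
  is the autocorrelation of \<open>F\<close> averaged against the transform of the Gaussian.
\<close>

lemma gauss_autocorrelation:
  assumes F: "integrable lborel F" and d: "d > 0"
  shows "complex_of_real (LINT t|lborel. (cmod (fourier F t))\<^sup>2 * exp (- (d * t)\<^sup>2 / 2))
    = complex_of_real (2 * pi) *
        (LINT x|lborel. LINT u|lborel. complex_of_real (normal_density 0 d u) * (F x * cnj (F (x + u))))"
    (is "complex_of_real ?L = _")
proof -
  define g where "g t = complex_of_real (exp (- (d * t)\<^sup>2 / 2))" for t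
  have [measurable]: "F \<in> borel_measurable borel"
    using F by auto
  have [measurable]: "g \<in> borel_measurable borel"
    unfolding g_def by measurable
  have g: "integrable lborel g"
    unfolding g_def using integrable_gauss[OF d] by simp
  have gb: "integrable lborel (\<lambda>t. g t * k t)" if "k \<in> borel_measurable borel" "\<And>t. cmod (k t) \<le> C" for k C
  proof (rule Bochner_Integration.integrable_bound[where f = "\<lambda>t. C * g t"])
    show "integrable lborel (\<lambda>t. C * g t)" using g by simp
    show "(\<lambda>t. g t * k t) \<in> borel_measurable lborel" using that by measurable
    have "C \<ge> 0" using order_trans[OF norm_ge_zero that(2)] .
    then show "AE t in lborel. cmod (g t * k t) \<le> cmod (complex_of_real C * g t)"
      using that(2) by (auto simp: norm_mult mult.commute[of "cmod (g _)"] intro!: mult_right_mono)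
  qed
  have intK: "integrable lborel (\<lambda>t. g t * cnj (fourier F t))"
    by (rule gb[where C = "LINT x|lborel. cmod (F x)"]) (auto simp: cmod_fourier_le)
  have inner: "fourier (\<lambda>t. g t * cnj (fourier F t)) x
       = 2 * pi * (LINT u|lborel. normal_density 0 d u * cnj (F (x + u)))" for x
  proof -
    define k where "k t = exp (\<i> * of_real t * of_real x) * g t" for t
    have "integrable lborel (\<lambda>t. g t * exp (\<i> * of_real t * of_real x))"
      by (rule gb[where C = 1]) (auto simp: norm_exp_eq_Re)
    then have k: "integrable lborel k" unfolding k_def by (subst mult.commute)
    have "fourier (\<lambda>t. g t * cnj (fourier F t)) x = cnj (LINT t|lborel. fourier F t * k t)"
      unfolding fourier_def[of "\<lambda>t. g t * cnj (fourier F t)"]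
      by (subst Bochner_Integration.integral_cnj[symmetric]) (auto simp: k_def exp_cnj g_def mult_ac intro!: Bochner_Integration.integral_cong)
    also have "(LINT t|lborel. fourier F t * k t) = (LINT y|lborel. F y * fourier k y)"
      by (rule fourier_multiplication_formula[OF F k])
    also have "\<dots> = (LINT y|lborel. F y * complex_of_real (2 * pi * normal_density 0 d (y - x)))"
      unfolding k_def fourier_modulation g_def fourier_gauss[OF d] ..
    also have "\<dots> = (LINT u|lborel. F (x + u) * complex_of_real (2 * pi * normal_density 0 d u))"
      by (subst lborel_integral_real_affine[where c = 1 and t = x]) auto
    also have "cnj \<dots> = (LINT u|lborel. complex_of_real (2 * pi) * (normal_density 0 d u * cnj (F (x + u))))"
      by (subst Bochner_Integration.integral_cnj[symmetric]) (auto simp: mult_ac intro!: Bochner_Integration.integral_cong)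
    also have "\<dots> = 2 * pi * (LINT u|lborel. normal_density 0 d u * cnj (F (x + u)))"
      by (subst integral_mult_right_zero) simp
    finally show ?thesis .
  qed
  have "complex_of_real ?L = (LINT t|lborel. fourier F t * (g t * cnj (fourier F t)))"
    by (subst integral_complex_of_real[symmetric])
       (auto intro!: Bochner_Integration.integral_cong simp: g_def complex_norm_square mult_ac simp del: of_real_power)
  also have "\<dots> = (LINT x|lborel. F x * fourier (\<lambda>t. g t * cnj (fourier F t)) x)"
    by (rule fourier_multiplication_formula[OF F intK])
  also have "\<dots> = (LINT x|lborel. complex_of_real (2 * pi) * (LINT u|lborel. normal_density 0 d u * (F x * cnj (F (x + u)))))"
  proof (intro Bochner_Integration.integral_cong refl)
    fix x
    have "(LINT u|lborel. normal_density 0 d u * (F x * cnj (F (x + u))))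
       = (LINT u|lborel. F x * (normal_density 0 d u * cnj (F (x + u))))"
      by (intro Bochner_Integration.integral_cong refl) (simp only: mult_ac)
    also have "\<dots> = F x * (LINT u|lborel. normal_density 0 d u * cnj (F (x + u)))"
      by (rule integral_mult_right_zero)
    finally show "F x * fourier (\<lambda>t. g t * cnj (fourier F t)) x
      = complex_of_real (2 * pi) * (LINT u|lborel. normal_density 0 d u * (F x * cnj (F (x + u))))"
      unfolding inner by (simp only: mult_ac)
  qed
  also have "\<dots> = complex_of_real (2 * pi) * (LINT x|lborel. LINT u|lborel. normal_density 0 d u * (F x * cnj (F (x + u))))"
    by (rule integral_mult_right_zero)
  finally show ?thesis .
qed

text \<open>
  Polarisation, \<open>2 Re (a * cnj b) = |a|\<^sup>2 + |b|\<^sup>2 - |a - b|\<^sup>2\<close>, turns the autocorrelation into the squared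
  norm of \<open>F\<close> minus a mean of the squared distances between \<open>F\<close> and its translates.
\<close>

lemma gauss_plancherel:
  assumes F: "integrable lborel F" and fin: "energy F < \<infinity>" and d: "d > 0"
  shows "(\<integral>\<^sup>+ t. ennreal ((cmod (fourier F t))\<^sup>2 * exp (- (d * t)\<^sup>2 / 2)) \<partial>lborel)
       + ennreal pi * (\<integral>\<^sup>+ u. ennreal (normal_density 0 d u) * energy (\<lambda>x. F (x + u) - F x) \<partial>lborel)
     = ennreal (2 * pi) * energy F"
proof -
  have [measurable]: "F \<in> borel_measurable borel" using F by auto
  let ?N = "normal_density 0 d" and ?M = "lborel \<Otimes>\<^sub>M lborel :: (real \<times> real) measure"
  have N: "(\<integral>\<^sup>+ u. ennreal (?N u) \<partial>lborel) = 1"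
    using d by (subst nn_integral_eq_integral) (auto simp: integrable_normal_density)
  define a where "a p = ?N (snd p) * (cmod (F (fst p)))\<^sup>2" for p :: "real \<times> real"
  define b where "b p = ?N (snd p) * (cmod (F (fst p + snd p)))\<^sup>2" for p :: "real \<times> real"
  define e where "e p = ?N (snd p) * (cmod (F (fst p + snd p) - F (fst p)))\<^sup>2" for p :: "real \<times> real"
  define R where "R p = ?N (snd p) * (F (fst p) * cnj (F (fst p + snd p)))" for p :: "real \<times> real"
  have meas [measurable]: "a \<in> borel_measurable ?M" "b \<in> borel_measurable ?M" "e \<in> borel_measurable ?M" "R \<in> borel_measurable ?M"
    unfolding a_def b_def e_def R_def by measurable
  have nn: "a p \<ge> 0" "b p \<ge> 0" "e p \<ge> 0" for p
    by (auto simp: a_def b_def e_def)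
  have R: "Re (R p) = (a p + b p - e p) / 2" "cmod (R p) \<le> a p + b p" for p
  proof -
    have *: "(cmod (z - w))\<^sup>2 = (cmod w)\<^sup>2 + (cmod z)\<^sup>2 - 2 * Re (w * cnj z)" for z w
      unfolding cmod_power2 by (simp add: power2_eq_square algebra_simps)
    show "Re (R p) = (a p + b p - e p) / 2"
      unfolding a_def b_def e_def R_def * by (simp add: algebra_simps)
    have "2 * (cmod (F (fst p)) * cmod (F (fst p + snd p))) \<le> (cmod (F (fst p)))\<^sup>2 + (cmod (F (fst p + snd p)))\<^sup>2"
      using sum_squares_bound[of "cmod (F (fst p))" "cmod (F (fst p + snd p))"] by (simp add: mult_ac)
    then have "cmod (F (fst p)) * cmod (F (fst p + snd p)) \<le> (cmod (F (fst p)))\<^sup>2 + (cmod (F (fst p + snd p)))\<^sup>2"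
      using mult_nonneg_nonneg[of "cmod (F (fst p))" "cmod (F (fst p + snd p))"] by (smt (verit) norm_ge_zero)
    then have "?N (snd p) * (cmod (F (fst p)) * cmod (F (fst p + snd p)))
         \<le> ?N (snd p) * ((cmod (F (fst p)))\<^sup>2 + (cmod (F (fst p + snd p)))\<^sup>2)"
      by (intro mult_left_mono) auto
    then show "cmod (R p) \<le> a p + b p"
      by (simp add: a_def b_def R_def norm_mult distrib_left)
  qed
  have slice: "(\<integral>\<^sup>+ p. ennreal (?N (snd p) * (cmod (k (fst p) (snd p)))\<^sup>2) \<partial>?M)
      = (\<integral>\<^sup>+ u. ennreal (?N u) * energy (\<lambda>x. k x u) \<partial>lborel)"
    if [measurable]: "(\<lambda>p. k (fst p) (snd p)) \<in> borel_measurable ?M" for k :: "real \<Rightarrow> real \<Rightarrow> complex"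
  proof -
    have [measurable]: "(\<lambda>x. k x u) \<in> borel_measurable borel" for u
    proof -
      have "(\<lambda>x. (x, u)) \<in> lborel \<rightarrow>\<^sub>M ?M" by simp
      from measurable_compose[OF this that] show ?thesis by simp
    qed
    have "(\<integral>\<^sup>+ p. ennreal (?N (snd p) * (cmod (k (fst p) (snd p)))\<^sup>2) \<partial>?M)
       = (\<integral>\<^sup>+ u. \<integral>\<^sup>+ x. ennreal (?N u * (cmod (k x u))\<^sup>2) \<partial>lborel \<partial>lborel)"
      by (subst lborel_pair.nn_integral_snd[symmetric]) auto
    also have "\<dots> = (\<integral>\<^sup>+ u. ennreal (?N u) * energy (\<lambda>x. k x u) \<partial>lborel)"
      unfolding energy_def by (intro nn_integral_cong) (simp add: ennreal_mult' nn_integral_cmult)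
    finally show ?thesis .
  qed
  have shift: "energy (\<lambda>x. F (x + u)) = energy F" for u
    unfolding energy_def using nn_integral_lborel_shift[of "\<lambda>x. ennreal ((cmod (F x))\<^sup>2)"] by simp
  have Na: "(\<integral>\<^sup>+ p. ennreal (a p) \<partial>?M) = energy F"
    unfolding a_def by (subst slice) (auto simp: nn_integral_multc N)
  have Nb: "(\<integral>\<^sup>+ p. ennreal (b p) \<partial>?M) = energy F"
    unfolding b_def by (subst slice[of "\<lambda>x u. F (x + u)"]) (auto simp: nn_integral_multc N shift)
  have Ne: "(\<integral>\<^sup>+ p. ennreal (e p) \<partial>?M) = (\<integral>\<^sup>+ u. ennreal (?N u) * energy (\<lambda>x. F (x + u) - F x) \<partial>lborel)"
    unfolding e_def by (rule slice) measurable
  have int: "integrable ?M a" "integrable ?M b"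
    unfolding integrable_iff_bounded using nn fin Na Nb by auto
  then have intR: "integrable ?M R"
    by (intro Bochner_Integration.integrable_bound[where f = "\<lambda>p. a p + b p" and g = R]) (auto simp: R nn)
  have inte: "integrable ?M e"
  proof -
    have "e p = a p + b p - 2 * Re (R p)" for p by (simp add: R field_simps)
    then have "e = (\<lambda>p. a p + b p - 2 * Re (R p))" by auto
    then show ?thesis using int intR by simp
  qed
  define E where "E = enn2real (energy F)"
  have E: "energy F = ennreal E" "E \<ge> 0" using fin by (auto simp: E_def)
  have "(LINT p|?M. a p) = E" "(LINT p|?M. b p) = E"
    using Na Nb nn E by (auto simp: integral_eq_nn_integral)
  then have LR: "Re (LINT p|?M. R p) = E - (LINT p|?M. e p) / 2"
    using int inte by (subst integral_Re[OF intR, symmetric]) (simp add: R)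
  let ?L = "LINT t|lborel. (cmod (fourier F t))\<^sup>2 * exp (- (d * t)\<^sup>2 / 2)"
  have "(LINT x|lborel. LINT u|lborel. complex_of_real (?N u) * (F x * cnj (F (x + u)))) = (LINT p|?M. R p)"
    using lborel_pair.integral_fst'[OF intR] unfolding R_def by simp
  then have "?L = 2 * pi * Re (LINT p|?M. R p)"
    using arg_cong[OF gauss_autocorrelation[OF F d], of Re] by simp
  then have L: "?L + pi * (LINT p|?M. e p) = 2 * pi * E"
    unfolding LR by (simp add: algebra_simps)
  have intL: "integrable lborel (\<lambda>t. (cmod (fourier F t))\<^sup>2 * exp (- (d * t)\<^sup>2 / 2))"
  proof (rule Bochner_Integration.integrable_bound)
    let ?C = "LINT x|lborel. cmod (F x)"
    show "integrable lborel (\<lambda>t. ?C\<^sup>2 * exp (- (d * t)\<^sup>2 / 2))"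
      using integrable_gauss[OF d] by simp
    have "(cmod (fourier F t))\<^sup>2 \<le> ?C\<^sup>2" for t
      by (intro power_mono cmod_fourier_le) auto
    then show "AE t in lborel. norm ((cmod (fourier F t))\<^sup>2 * exp (- (d * t)\<^sup>2 / 2)) \<le> norm (?C\<^sup>2 * exp (- (d * t)\<^sup>2 / 2))"
      by (auto simp: abs_mult intro!: mult_right_mono)
  qed measurable
  have "(\<integral>\<^sup>+ t. ennreal ((cmod (fourier F t))\<^sup>2 * exp (- (d * t)\<^sup>2 / 2)) \<partial>lborel) = ennreal ?L"
    by (rule nn_integral_eq_integral[OF intL]) auto
  moreover have "(\<integral>\<^sup>+ p. ennreal (e p) \<partial>?M) = ennreal (LINT p|?M. e p)"
    by (rule nn_integral_eq_integral[OF inte]) (auto simp: nn)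
  moreover have "?L \<ge> 0" "(LINT p|?M. e p) \<ge> 0"
    using nn by (auto intro!: Bochner_Integration.integral_nonneg)
  ultimately show ?thesis
    unfolding Ne[symmetric] E(1) using L E(2) by (simp flip: ennreal_mult ennreal_plus)
qed

text \<open>
  In \<open>gauss_plancherel\<close> let \<open>d\<close> tend to \<open>0\<close>: the Gaussian weight increases to \<open>1\<close>, while the normal
  density concentrates at the shift \<open>0\<close>, where translation is continuous.
\<close>

theorem plancherel_L1_L2:
  assumes F: "integrable lborel F" and fin: "energy F < \<infinity>"
  shows "energy (fourier F) = ennreal (2 * pi) * energy F"
proof -
  have [measurable]: "F \<in> borel_measurable borel" using F by auto
  define d where "d n = inverse (real (Suc n))" for n
  have d0: "d \<longlonglongrightarrow> 0" and dpos: "d n > 0" for n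
    unfolding d_def by (rule LIMSEQ_inverse_real_of_nat) auto
  let ?T = "\<lambda>u. energy (\<lambda>x. F (x + u) - F x)"
  have [measurable]: "?T \<in> borel_measurable borel" unfolding energy_def by measurable
  have "(\<lambda>n. \<integral>\<^sup>+ t. ennreal ((cmod (fourier F t))\<^sup>2 * exp (- (d n * t)\<^sup>2 / 2)) \<partial>lborel) \<longlonglongrightarrow> energy (fourier F)"
    unfolding energy_def
  proof (rule nn_integral_LIMSEQ)
    show "incseq (\<lambda>n t. ennreal ((cmod (fourier F t))\<^sup>2 * exp (- (d n * t)\<^sup>2 / 2)))"
    proof (rule incseq_SucI, rule le_funI)
      fix n t
      have "d (Suc n) \<le> d n" by (simp add: d_def field_simps)
      then have "(d (Suc n))\<^sup>2 * t\<^sup>2 \<le> (d n)\<^sup>2 * t\<^sup>2"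
        using dpos[of "Suc n"] by (intro mult_right_mono power_mono) auto
      then show "ennreal ((cmod (fourier F t))\<^sup>2 * exp (- (d n * t)\<^sup>2 / 2))
         \<le> ennreal ((cmod (fourier F t))\<^sup>2 * exp (- (d (Suc n) * t)\<^sup>2 / 2))"
        by (intro ennreal_leI mult_left_mono) (auto simp: power_mult_distrib)
    qed
    fix t
    have "(\<lambda>n. (cmod (fourier F t))\<^sup>2 * exp (- (d n * t)\<^sup>2 / 2)) \<longlonglongrightarrow> (cmod (fourier F t))\<^sup>2 * exp (- (0 * t)\<^sup>2 / 2)"
      by (intro tendsto_intros d0) auto
    then show "(\<lambda>n. ennreal ((cmod (fourier F t))\<^sup>2 * exp (- (d n * t)\<^sup>2 / 2))) \<longlonglongrightarrow> ennreal ((cmod (fourier F t))\<^sup>2)"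
      by (intro tendsto_ennrealI) simp
  qed measurable
  moreover have "(\<lambda>n. ennreal pi * (\<integral>\<^sup>+ u. ennreal (normal_density 0 (d n) u) * ?T u \<partial>lborel)) \<longlonglongrightarrow> ennreal pi * 0"
  proof (rule ennreal_tendsto_cmult)
    have eq: "(\<integral>\<^sup>+ u. ennreal (normal_density 0 (d n) u) * ?T u \<partial>lborel)
        = (\<integral>\<^sup>+ v. ennreal (std_normal_density v) * ?T (d n * v) \<partial>lborel)" for n
    proof -
      have "(\<integral>\<^sup>+ u. ennreal (normal_density 0 (d n) u) * ?T u \<partial>lborel)
          = ennreal \<bar>d n\<bar> * (\<integral>\<^sup>+ v. ennreal (normal_density 0 (d n) (0 + d n * v)) * ?T (0 + d n * v) \<partial>lborel)"
        using dpos[of n] by (intro nn_integral_real_affine) auto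
      also have "\<dots> = (\<integral>\<^sup>+ v. ennreal (d n) * (ennreal (normal_density 0 (d n) (d n * v)) * ?T (d n * v)) \<partial>lborel)"
        using dpos[of n] by (subst nn_integral_cmult) auto
      also have "\<dots> = (\<integral>\<^sup>+ v. ennreal (std_normal_density v) * ?T (d n * v) \<partial>lborel)"
      proof (intro nn_integral_cong)
        fix v
        have "d n * normal_density 0 (d n) (d n * v) = std_normal_density v"
          using dpos[of n] by (simp add: normal_density_def real_sqrt_mult power_mult_distrib field_simps)
        then show "ennreal (d n) * (ennreal (normal_density 0 (d n) (d n * v)) * ?T (d n * v))
           = ennreal (std_normal_density v) * ?T (d n * v)"
          using dpos[of n] by (simp flip: mult.assoc ennreal_mult')
      qed
      finally show ?thesis .
    qed
    have "(\<lambda>n. \<integral>\<^sup>+ v. ennreal (std_normal_density v) * ?T (d n * v) \<partial>lborel) \<longlonglongrightarrow> (\<integral>\<^sup>+ v. 0 \<partial>(lborel :: real measure))"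
    proof (rule nn_integral_dominated_convergence[where w = "\<lambda>v. ennreal (std_normal_density v) * (4 * energy F)"])
      have T4: "?T u \<le> 4 * energy F" for u
      proof -
        have shift: "energy (\<lambda>x. F (x + u)) = energy F"
          unfolding energy_def using nn_integral_lborel_shift[of "\<lambda>x. ennreal ((cmod (F x))\<^sup>2)"] by simp
        have "?T u = energy (\<lambda>x. F (x + u) + - F x)" by simp
        also have "\<dots> \<le> ennreal (1 + 1) * energy (\<lambda>x. F (x + u)) + ennreal (1 + 1 / 1) * energy (\<lambda>x. - F x)"
          by (intro energy_add_le) auto
        also have "\<dots> = 4 * energy F"
          unfolding shift energy_uminus by (simp flip: distrib_right)
        finally show ?thesis .
      qed
      then show "AE v in lborel. ennreal (std_normal_density v) * ?T (d n * v) \<le> ennreal (std_normal_density v) * (4 * energy F)" for n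
        by (intro AE_I2 mult_left_mono) auto
      have "(\<integral>\<^sup>+ v. ennreal (std_normal_density v) \<partial>lborel) = 1"
        by (subst nn_integral_eq_integral) (auto simp: integrable_normal_density)
      then show "(\<integral>\<^sup>+ v. ennreal (std_normal_density v) * (4 * energy F) \<partial>lborel) < \<infinity>"
        using fin by (simp add: nn_integral_multc ennreal_mult_less_top)
      show "AE v in lborel. (\<lambda>n. ennreal (std_normal_density v) * ?T (d n * v)) \<longlonglongrightarrow> 0"
      proof (rule AE_I2)
        fix v
        have "(\<lambda>n. d n * v) \<longlonglongrightarrow> 0 * v" by (intro tendsto_intros d0)
        then have "(\<lambda>n. ?T (d n * v)) \<longlonglongrightarrow> 0" by (intro energy_shift_tendsto fin) auto
        then have "(\<lambda>n. ennreal (std_normal_density v) * ?T (d n * v)) \<longlonglongrightarrow> ennreal (std_normal_density v) * 0"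
          by (intro ennreal_tendsto_cmult) auto
        then show "(\<lambda>n. ennreal (std_normal_density v) * ?T (d n * v)) \<longlonglongrightarrow> 0" by simp
      qed
    qed auto
    then show "(\<lambda>n. \<integral>\<^sup>+ u. ennreal (normal_density 0 (d n) u) * ?T u \<partial>lborel) \<longlonglongrightarrow> 0"
      unfolding eq by simp
  qed auto
  ultimately have "(\<lambda>n. (\<integral>\<^sup>+ t. ennreal ((cmod (fourier F t))\<^sup>2 * exp (- (d n * t)\<^sup>2 / 2)) \<partial>lborel)
       + ennreal pi * (\<integral>\<^sup>+ u. ennreal (normal_density 0 (d n) u) * ?T u \<partial>lborel))
     \<longlonglongrightarrow> energy (fourier F) + ennreal pi * 0"
    by (rule tendsto_add)
  then have "(\<lambda>n. ennreal (2 * pi) * energy F) \<longlonglongrightarrow> energy (fourier F) + ennreal pi * 0"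
    unfolding gauss_plancherel[OF F fin dpos] .
  then show ?thesis by (simp add: LIMSEQ_const_iff)
qed

section \<open>Plancherel's theorem for square-integrable functions\<close>

text \<open>
  The core of the completeness of \<open>L\<^sup>2\<close>. The factors \<open>2\<^sup>k\<close> leave the sum of the squared increments
  integrable, and their finiteness at a point forces geometric decay of the increments there.
\<close>

lemma L2_summable_increments_limit:
  fixes u :: "nat \<Rightarrow> real \<Rightarrow> complex"
  assumes [measurable]: "\<And>k. u k \<in> borel_measurable borel"
    and le: "\<And>k. energy (\<lambda>x. u (Suc k) x - u k x) \<le> ennreal ((1 / 4) ^ k)"
  shows "\<exists>g \<in> borel_measurable borel. AE x in lborel. (\<lambda>k. u k x) \<longlonglongrightarrow> g x"
proof (intro bexI)
  define w where "w k x = ennreal (2 ^ k * (cmod (u (Suc k) x - u k x))\<^sup>2)" for k x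
  have [measurable]: "w k \<in> borel_measurable borel" for k
    unfolding w_def by measurable
  have "(\<integral>\<^sup>+ x. w k x \<partial>lborel) \<le> ennreal ((1 / 2) ^ k)" for k
  proof -
    have "(\<integral>\<^sup>+ x. w k x \<partial>lborel) = ennreal (2 ^ k) * energy (\<lambda>x. u (Suc k) x - u k x)"
      unfolding w_def energy_def by (subst nn_integral_cmult[symmetric]) (auto simp: ennreal_mult'')
    also have "\<dots> \<le> ennreal (2 ^ k) * ennreal ((1 / 4) ^ k)"
      by (intro mult_left_mono le) auto
    also have "\<dots> = ennreal ((1 / 2) ^ k)"
      by (simp flip: ennreal_mult'' power_mult_distrib)
    finally show ?thesis .
  qed
  then have "(\<Sum>k. \<integral>\<^sup>+ x. w k x \<partial>lborel) \<le> (\<Sum>k. ennreal ((1 / 2) ^ k))"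
    by (intro suminf_le) auto
  also have "\<dots> < \<infinity>"
    by (subst suminf_ennreal2) (auto intro!: summable_geometric)
  finally have "(\<integral>\<^sup>+ x. (\<Sum>k. w k x) \<partial>lborel) < \<infinity>"
    by (subst nn_integral_suminf) auto
  then have "AE x in lborel. (\<Sum>k. w k x) \<noteq> \<infinity>"
    by (intro nn_integral_noteq_infinite) auto
  then show "AE x in lborel. (\<lambda>k. u k x) \<longlonglongrightarrow> lim (\<lambda>k. u k x)"
  proof eventually_elim
    case (elim x)
    have "summable (\<lambda>k. 2 ^ k * (cmod (u (Suc k) x - u k x))\<^sup>2)"
      using elim by (intro summable_suminf_not_top) (auto simp: w_def)
    then have "Bseq (\<lambda>k. 2 ^ k * (cmod (u (Suc k) x - u k x))\<^sup>2)"
      by (rule convergent_imp_Bseq[OF convergentI[OF summable_LIMSEQ_zero]])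
    then obtain C where C: "C > 0" "\<And>k. norm (2 ^ k * (cmod (u (Suc k) x - u k x))\<^sup>2) \<le> C"
      unfolding Bseq_def by blast
    have "cmod (u (Suc k) x - u k x) \<le> sqrt C * sqrt (1 / 2) ^ k" for k
    proof -
      have "(cmod (u (Suc k) x - u k x))\<^sup>2 \<le> C * (1 / 2) ^ k"
        using C(2)[of k] by (simp add: field_simps)
      then have "cmod (u (Suc k) x - u k x) \<le> sqrt (C * (1 / 2) ^ k)"
        by (rule real_le_rsqrt)
      then show ?thesis by (simp add: real_sqrt_mult real_sqrt_power)
    qed
    moreover have "summable (\<lambda>k. sqrt C * sqrt (1 / 2) ^ k)"
      by (intro summable_mult summable_geometric) (auto simp: real_sqrt_lt_1_iff)
    ultimately have "summable (\<lambda>k. u (Suc k) x - u k x)"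
      by (rule summable_comparison_test'[where N = 0, rotated])
    moreover have "(\<lambda>n. \<Sum>k<n. u (Suc k) x - u k x) = (\<lambda>n. u n x - u 0 x)"
      by (intro ext sum_lessThan_telescope[of "\<lambda>k. u k x"])
    ultimately have "convergent (\<lambda>n. u n x - u 0 x)"
      by (simp only: summable_iff_convergent)
    then obtain L where "(\<lambda>n. u n x - u 0 x) \<longlonglongrightarrow> L"
      by (auto simp: convergent_def)
    then have "(\<lambda>n. (u n x - u 0 x) + u 0 x) \<longlonglongrightarrow> L + u 0 x"
      by (intro tendsto_intros)
    then have "convergent (\<lambda>n. u n x)" by (auto simp: convergent_def)
    then show ?case by (simp add: convergent_LIMSEQ_iff)
  qed
qed measurable

text \<open>
  On causal functions, which vanish on the left half-line, this is the truncation to \<open>(0,R)\<close>; the symmetric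
  interval also serves for functions on a vertical line.
\<close>

definition cutoff :: "real \<Rightarrow> (real \<Rightarrow> complex) \<Rightarrow> real \<Rightarrow> complex" where
  "cutoff R G x = indicator {-R<..<R} x * G x"

lemma borel_measurable_cutoff [measurable]:
  assumes [measurable]: "G \<in> borel_measurable borel"
  shows "cutoff R G \<in> borel_measurable borel"
  unfolding cutoff_def by measurable

lemma integrable_cutoff:
  assumes [measurable]: "G \<in> borel_measurable borel" and fin: "energy G < \<infinity>"
  shows "integrable lborel (cutoff R G)"
proof -
  have "(\<integral>\<^sup>+ x. norm (cutoff R G x) \<partial>lborel)
     \<le> (\<integral>\<^sup>+ x. indicator {-R<..<R} x + ennreal ((cmod (G x))\<^sup>2) \<partial>lborel)"
  proof (intro nn_integral_mono)
    fix x
    have "cmod (G x) \<le> 1 + (cmod (G x))\<^sup>2"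
      using sum_squares_bound[of "cmod (G x)" 1] norm_ge_zero[of "G x"] unfolding power2_eq_square by linarith
    then show "ennreal (norm (cutoff R G x)) \<le> indicator {-R<..<R} x + ennreal ((cmod (G x))\<^sup>2)"
      by (auto simp: cutoff_def indicator_def simp flip: ennreal_plus ennreal_1)
  qed
  also have "\<dots> = emeasure lborel {-R<..<R} + energy G"
    by (simp add: nn_integral_add energy_def)
  also have "\<dots> < \<infinity>"
    using fin by (cases "R \<ge> 0") auto
  finally show ?thesis
    unfolding integrable_iff_bounded by auto
qed

lemma fourier_diff:
  assumes "integrable lborel F" "integrable lborel G"
  shows "fourier (\<lambda>x. F x - G x) t = fourier F t - fourier G t"
  unfolding fourier_def
  by (subst Bochner_Integration.integral_diff[symmetric, OF integrable_fourier_kernel integrable_fourier_kernel])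
     (auto intro!: assms Bochner_Integration.integral_cong simp: right_diff_distrib)

lemma energy_mono: "(\<And>x. cmod (F x) \<le> cmod (G x)) \<Longrightarrow> energy F \<le> energy G"
  unfolding energy_def by (intro nn_integral_mono ennreal_leI power_mono) auto

lemma energy_tail_tendsto:
  assumes [measurable]: "G \<in> borel_measurable borel" and fin: "energy G < \<infinity>"
  shows "((\<lambda>R. energy (\<lambda>x. G x - cutoff R G x)) \<longlongrightarrow> 0) at_top"
proof -
  have "((\<lambda>n. energy (\<lambda>x. G x - cutoff (real n) G x)) \<longlonglongrightarrow> (\<integral>\<^sup>+ x. 0 \<partial>(lborel :: real measure)))"
    unfolding energy_def
  proof (rule nn_integral_dominated_convergence[where w = "\<lambda>x. ennreal ((cmod (G x))\<^sup>2)"])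
    show "(\<integral>\<^sup>+ x. ennreal ((cmod (G x))\<^sup>2) \<partial>lborel) < \<infinity>" using fin by (simp add: energy_def)
    show "AE x in lborel. (\<lambda>n. ennreal ((cmod (G x - cutoff (real n) G x))\<^sup>2)) \<longlonglongrightarrow> 0"
    proof (intro AE_I2 tendsto_eventually)
      fix x :: real
      show "\<forall>\<^sub>F n in sequentially. ennreal ((cmod (G x - cutoff (real n) G x))\<^sup>2) = 0"
        using eventually_gt_at_top[of "nat \<lceil>\<bar>x\<bar>\<rceil>"]
      proof eventually_elim
        case (elim n)
        then have "\<bar>x\<bar> < real n" by linarith
        then show ?case by (auto simp: cutoff_def indicator_def abs_less_iff)
      qed
    qed
  qed (auto simp: cutoff_def indicator_def)
  then have lim: "(\<lambda>n. energy (\<lambda>x. G x - cutoff (real n) G x)) \<longlonglongrightarrow> 0" by simp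
  have mono: "energy (\<lambda>x. G x - cutoff S G x) \<le> energy (\<lambda>x. G x - cutoff R G x)" if "R \<le> S" for R S
    using that by (intro energy_mono) (auto simp: cutoff_def indicator_def)
  show ?thesis
  proof (rule order_tendstoI)
    fix a :: ennreal assume "0 < a"
    then have "\<forall>\<^sub>F n in sequentially. energy (\<lambda>x. G x - cutoff (real n) G x) < a"
      by (rule order_tendstoD(2)[OF lim])
    then obtain n where n: "energy (\<lambda>x. G x - cutoff (real n) G x) < a"
      by (auto simp: eventually_sequentially)
    show "\<forall>\<^sub>F R in at_top. energy (\<lambda>x. G x - cutoff R G x) < a"
      using eventually_ge_at_top[of "real n"]
      by eventually_elim (rule le_less_trans[OF mono n])
  qed auto
qed

text \<open>
  The truncations are in \<open>L\<^sup>1 \<inter> L\<^sup>2\<close>, and both sides of the identity are continuous in \<open>L\<^sup>2\<close>.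
  Every \<open>L\<^sup>2\<close> limit of the truncated Fourier integrals is covered, as the transform is determined only
  up to null sets.
\<close>

theorem plancherel_L2_isometry:
  assumes [measurable]: "G \<in> borel_measurable borel" and fin: "energy G < \<infinity>"
    and [measurable]: "g \<in> borel_measurable borel"
    and conv: "((\<lambda>R. energy (\<lambda>t. g t - fourier (cutoff R G) t)) \<longlongrightarrow> 0) at_top"
  shows "energy g = ennreal (2 * pi) * energy G"
proof (rule energy_limit[where F = "\<lambda>n. fourier (cutoff (real n) G)"])
  show "(\<lambda>n. energy (\<lambda>t. g t - fourier (cutoff (real n) G) t)) \<longlonglongrightarrow> 0"
    by (rule filterlim_compose[OF conv filterlim_real_sequentially])
  have "(\<lambda>n. energy (cutoff (real n) G)) \<longlonglongrightarrow> energy G"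
    unfolding energy_def
  proof (rule nn_integral_LIMSEQ)
    show "incseq (\<lambda>n x. ennreal ((cmod (cutoff (real n) G x))\<^sup>2))"
      by (auto simp: incseq_def le_fun_def cutoff_def indicator_def)
    show "(\<lambda>n. ennreal ((cmod (cutoff (real n) G x))\<^sup>2)) \<longlonglongrightarrow> ennreal ((cmod (G x))\<^sup>2)" for x
    proof (rule tendsto_eventually)
      show "\<forall>\<^sub>F n in sequentially. ennreal ((cmod (cutoff (real n) G x))\<^sup>2) = ennreal ((cmod (G x))\<^sup>2)"
        using eventually_gt_at_top[of "nat \<lceil>\<bar>x\<bar>\<rceil>"]
    proof eventually_elim
      case (elim n)
      then have "\<bar>x\<bar> < real n" by linarith
      then show ?case by (auto simp: cutoff_def indicator_def abs_less_iff)
    qed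
    qed
  qed measurable
  then have "(\<lambda>n. ennreal (2 * pi) * energy (cutoff (real n) G)) \<longlonglongrightarrow> ennreal (2 * pi) * energy G"
    by (intro ennreal_tendsto_cmult) auto
  moreover have "energy (fourier (cutoff R G)) = ennreal (2 * pi) * energy (cutoff R G)" for R
  proof (rule plancherel_L1_L2[OF integrable_cutoff[OF assms(1,2)]])
    have "energy (cutoff R G) \<le> energy G"
      by (intro energy_mono) (auto simp: cutoff_def indicator_def)
    then show "energy (cutoff R G) < \<infinity>" using fin by auto
  qed
  ultimately show "(\<lambda>n. energy (fourier (cutoff (real n) G))) \<longlonglongrightarrow> ennreal (2 * pi) * energy G"
    by simp
qed auto

text \<open>
  By the identity on \<open>L\<^sup>1 \<inter> L\<^sup>2\<close>, the transforms of two truncations differ by no more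
  than the tail of \<open>G\<close>. Along a sequence of rapidly growing radii they therefore converge almost
  everywhere, and Fatou's lemma shows that the pointwise limit is the \<open>L\<^sup>2\<close> limit over all radii.
\<close>

theorem plancherel_L2_exists:
  assumes [measurable]: "G \<in> borel_measurable borel" and fin: "energy G < \<infinity>"
  shows "\<exists>g \<in> borel_measurable borel.
           ((\<lambda>R. energy (\<lambda>t. g t - fourier (cutoff R G) t)) \<longlongrightarrow> 0) at_top"
proof -
  define tail where "tail R = energy (\<lambda>x. G x - cutoff R G x)" for R
  have tail0: "((\<lambda>R. ennreal (2 * pi) * tail R) \<longlongrightarrow> 0) at_top"
    using ennreal_tendsto_cmult[OF _ energy_tail_tendsto[OF assms], of "ennreal (2 * pi)"]
    by (simp add: tail_def)
  have diff: "energy (\<lambda>t. fourier (cutoff S G) t - fourier (cutoff R G) t) \<le> ennreal (2 * pi) * tail R"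
    if "R \<le> S" for R S
  proof -
    have "energy (\<lambda>x. cutoff S G x - cutoff R G x) \<le> tail R"
      unfolding tail_def using that by (intro energy_mono) (auto simp: cutoff_def indicator_def)
    moreover have "tail R \<le> energy G"
      unfolding tail_def by (intro energy_mono) (auto simp: cutoff_def indicator_def)
    ultimately have "energy (\<lambda>x. cutoff S G x - cutoff R G x) < \<infinity>" 
      and le: "ennreal (2 * pi) * energy (\<lambda>x. cutoff S G x - cutoff R G x) \<le> ennreal (2 * pi) * tail R"
      using fin by (auto intro!: mult_left_mono)
    moreover have "integrable lborel (\<lambda>x. cutoff S G x - cutoff R G x)"
      using integrable_cutoff[OF assms] by auto
    ultimately have "energy (fourier (\<lambda>x. cutoff S G x - cutoff R G x)) \<le> ennreal (2 * pi) * tail R"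
      using le plancherel_L1_L2[of "\<lambda>x. cutoff S G x - cutoff R G x"] by simp
    moreover have "fourier (\<lambda>x. cutoff S G x - cutoff R G x) = (\<lambda>t. fourier (cutoff S G) t - fourier (cutoff R G) t)"
      by (intro ext fourier_diff integrable_cutoff[OF assms])
    ultimately show ?thesis by simp
  qed
  \<comment> \<open>The radii must increase for \<open>diff\<close> to apply, and be at least \<open>k\<close> so that they end up beyond every fixed radius.\<close>
  have "\<exists>r. \<forall>k. (ennreal (2 * pi) * tail (r k) \<le> ennreal ((1 / 4) ^ k) \<and> r k \<ge> real k) \<and> r k \<le> r (Suc k)"
  proof (rule dependent_nat_choice)
    have *: "\<exists>y. (ennreal (2 * pi) * tail y \<le> ennreal ((1 / 4) ^ n) \<and> y \<ge> real n) \<and> x \<le> y" for n x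
    proof -
      have "\<forall>\<^sub>F R in at_top. ennreal (2 * pi) * tail R < ennreal ((1 / 4) ^ n)"
        by (rule order_tendstoD[OF tail0]) auto
      then have "\<forall>\<^sub>F R in at_top. ennreal (2 * pi) * tail R \<le> ennreal ((1 / 4) ^ n) \<and> R \<ge> real n \<and> x \<le> R"
        using eventually_ge_at_top[of "real n"] eventually_ge_at_top[of x]
        by eventually_elim auto
      then show ?thesis
        using eventually_happens'[OF trivial_limit_at_top_linorder] by blast
    qed
    show "\<exists>x. ennreal (2 * pi) * tail x \<le> ennreal ((1 / 4) ^ 0) \<and> real 0 \<le> x"
      using * by blast
    show "\<exists>y. (ennreal (2 * pi) * tail y \<le> ennreal ((1 / 4) ^ Suc n) \<and> y \<ge> real (Suc n)) \<and> x \<le> y" for n x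
      using * by blast
  qed
  then obtain r where r: "\<And>k. ennreal (2 * pi) * tail (r k) \<le> ennreal ((1 / 4) ^ k)"
      "\<And>k. r k \<ge> real k" "\<And>k. r k \<le> r (Suc k)"
    by blast
  have "\<exists>g \<in> borel_measurable borel. AE t in lborel. (\<lambda>k. fourier (cutoff (r k) G) t) \<longlonglongrightarrow> g t"
    using order_trans[OF diff[OF r(3)] r(1)] by (intro L2_summable_increments_limit) auto
  then obtain g where [measurable]: "g \<in> borel_measurable borel"
    and g: "AE t in lborel. (\<lambda>k. fourier (cutoff (r k) G) t) \<longlonglongrightarrow> g t" by auto
  have le: "energy (\<lambda>t. g t - fourier (cutoff R G) t) \<le> ennreal (2 * pi) * tail R" for R
  proof -
    have "energy (\<lambda>t. g t - fourier (cutoff R G) t)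
        = (\<integral>\<^sup>+ t. liminf (\<lambda>k. ennreal ((cmod (fourier (cutoff (r k) G) t - fourier (cutoff R G) t))\<^sup>2)) \<partial>lborel)"
      unfolding energy_def
    proof (rule nn_integral_cong_AE)
      show "AE t in lborel. ennreal ((cmod (g t - fourier (cutoff R G) t))\<^sup>2)
          = liminf (\<lambda>k. ennreal ((cmod (fourier (cutoff (r k) G) t - fourier (cutoff R G) t))\<^sup>2))"
        using g
      proof eventually_elim
        case (elim t)
        then have "(\<lambda>k. ennreal ((cmod (fourier (cutoff (r k) G) t - fourier (cutoff R G) t))\<^sup>2))
            \<longlonglongrightarrow> ennreal ((cmod (g t - fourier (cutoff R G) t))\<^sup>2)"
          by (intro tendsto_intros tendsto_ennrealI)
        from lim_imp_Liminf[OF _ this] show ?case by simp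
      qed
    qed
    also have "\<dots> \<le> liminf (\<lambda>k. energy (\<lambda>t. fourier (cutoff (r k) G) t - fourier (cutoff R G) t))"
      unfolding energy_def by (rule nn_integral_liminf) measurable
    also have "\<dots> \<le> ennreal (2 * pi) * tail R"
    proof (rule Liminf_le)
      show "\<forall>\<^sub>F k in sequentially. energy (\<lambda>t. fourier (cutoff (r k) G) t - fourier (cutoff R G) t) \<le> ennreal (2 * pi) * tail R"
        using eventually_ge_at_top[of "nat \<lceil>R\<rceil>"]
      proof eventually_elim
        case (elim k)
        then have "R \<le> real k" by linarith
        with r(2)[of k] show ?case by (intro diff) linarith
      qed
    qed auto
    finally show ?thesis .
  qed
  have conv: "((\<lambda>R. energy (\<lambda>t. g t - fourier (cutoff R G) t)) \<longlongrightarrow> 0) at_top"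
    by (rule tendsto_sandwich[OF _ _ tendsto_const tail0]) (auto simp: le)
  then show ?thesis by (intro bexI[of _ g]) auto
qed

section \<open>The Cauchy kernel\<close>

lemma
  assumes [measurable]: "F \<in> borel_measurable borel" "G \<in> borel_measurable borel"
    and fin: "energy F < \<infinity>" "energy G < \<infinity>"
  shows integrable_mult_energy: "integrable lborel (\<lambda>x. F x * G x)"
    and cmod_integral_mult_le: "ennreal ((cmod (LINT x|lborel. F x * G x))\<^sup>2) \<le> energy F * energy G"
proof -
  have CS: "(\<integral>\<^sup>+ x. norm (F x * G x) \<partial>lborel)\<^sup>2 \<le> energy F * energy G"
    using Cauchy_Schwarz_nn_integral[of "\<lambda>x. ennreal (cmod (F x))" lborel "\<lambda>x. ennreal (cmod (G x))"]
    by (simp add: energy_def norm_mult ennreal_mult'' ennreal_power)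
  also have "\<dots> < \<infinity>" using fin by (simp add: ennreal_mult_less_top)
  finally have "(\<integral>\<^sup>+ x. norm (F x * G x) \<partial>lborel) < \<infinity>"
    by (auto simp: power2_eq_square ennreal_mult_less_top less_top)
  then show int: "integrable lborel (\<lambda>x. F x * G x)"
    unfolding integrable_iff_bounded by auto
  have "ennreal ((cmod (LINT x|lborel. F x * G x))\<^sup>2) = (ennreal (cmod (LINT x|lborel. F x * G x)))\<^sup>2"
    by (simp add: ennreal_power)
  also have "\<dots> \<le> (\<integral>\<^sup>+ x. norm (F x * G x) \<partial>lborel)\<^sup>2"
    using integral_norm_bound_ennreal[OF int] by (intro power_mono) auto
  also note CS
  finally show "ennreal ((cmod (LINT x|lborel. F x * G x))\<^sup>2) \<le> energy F * energy G" .
qed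

lemma nn_integral_Cauchy_density: "(\<integral>\<^sup>+ x. ennreal (inverse (1 + x\<^sup>2)) \<partial>lborel) = ennreal pi"
proof -
  have "integrable lborel (\<lambda>x::real. inverse (1 + x\<^sup>2))"
    using integrable_inverse_1_plus_square by (simp add: set_integrable_def)
  moreover have "(LINT x|lborel. inverse (1 + x\<^sup>2)) = pi"
    using LBINT_inverse_1_plus_square
    by (simp add: interval_lebesgue_integral_def set_lebesgue_integral_def)
  ultimately show ?thesis
    by (subst nn_integral_eq_integral) (auto intro!: AE_I2 simp: add_nonneg_nonneg)
qed

text \<open>
  The substitution \<open>t \<mapsto> Im z + b t\<close> with \<open>b = |s - Re z|\<close> leads to the integral of \<open>1 / (1 + t\<^sup>2)\<close>. The
  value decays as the line moves away from \<open>z\<close>, so that Cauchy integrals of a Hardy function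
  over far lines vanish.
\<close>

lemma energy_Cauchy_kernel:
  assumes "s \<noteq> Re z"
  shows "energy (\<lambda>t. 1 / (Complex s t - z)) = ennreal (pi / \<bar>s - Re z\<bar>)"
proof -
  define b where "b = \<bar>s - Re z\<bar>"
  have b: "b > 0" using assms by (simp add: b_def)
  have "energy (\<lambda>t. 1 / (Complex s t - z)) = (\<integral>\<^sup>+ t. ennreal (inverse (b\<^sup>2 + (t - Im z)\<^sup>2)) \<partial>lborel)"
    unfolding energy_def
    by (intro nn_integral_cong arg_cong[where f = ennreal])
       (simp add: norm_divide power_divide cmod_power2 b_def inverse_eq_divide)
  also have "\<dots> = ennreal \<bar>b\<bar> * (\<integral>\<^sup>+ t. ennreal (inverse (b\<^sup>2 + (Im z + b * t - Im z)\<^sup>2)) \<partial>lborel)"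
    using b by (intro nn_integral_real_affine) auto
  also have "(\<integral>\<^sup>+ t. ennreal (inverse (b\<^sup>2 + (Im z + b * t - Im z)\<^sup>2)) \<partial>lborel)
      = (\<integral>\<^sup>+ t. ennreal (inverse (b\<^sup>2)) * ennreal (inverse (1 + t\<^sup>2)) \<partial>lborel)"
  proof (intro nn_integral_cong)
    fix t
    have "b\<^sup>2 + (Im z + b * t - Im z)\<^sup>2 = b\<^sup>2 * (1 + t\<^sup>2)"
      by (simp add: power_mult_distrib distrib_left)
    then show "ennreal (inverse (b\<^sup>2 + (Im z + b * t - Im z)\<^sup>2)) = ennreal (inverse (b\<^sup>2)) * ennreal (inverse (1 + t\<^sup>2))"
      by (simp add: ennreal_mult)
  qed
  also have "\<dots> = ennreal (inverse (b\<^sup>2)) * ennreal pi"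
    by (simp add: nn_integral_cmult nn_integral_Cauchy_density)
  also have "ennreal \<bar>b\<bar> * \<dots> = ennreal (pi / b)"
    using b by (simp add: power2_eq_square field_simps flip: ennreal_mult)
  finally show ?thesis by (simp add: b_def)
qed

section \<open>Cauchy's formula on a half-plane\<close>

lemma borel_measurable_Complex [measurable]:
  assumes [measurable]: "f \<in> borel_measurable M" "g \<in> borel_measurable M"
  shows "(\<lambda>x. Complex (f x) (g x)) \<in> borel_measurable M"
  unfolding Complex_eq by measurable

lemma open_half_plane [simp]: "open (half_plane c)"
  unfolding half_plane_def by (rule open_halfspace_Re_gt)

lemma continuous_on_line:
  assumes "continuous_on (half_plane c) h" "c < s"
  shows "continuous_on A (\<lambda>t. h (Complex s t))"
  using assms(2) unfolding Complex_eq
  by (intro continuous_on_compose2[OF assms(1)] continuous_intros) (auto simp: half_plane_def)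

lemma borel_measurable_line:
  assumes "continuous_on (half_plane c) h" "c < s"
  shows "(\<lambda>t. h (Complex s t)) \<in> borel_measurable borel"
  by (intro borel_measurable_continuous_onI continuous_on_line[OF assms])

text \<open>
  On a horizontal segment no pointwise bound for \<open>h\<close> is at hand. But by Fubini's theorem the mean of the
  two horizontal integrals over heights in a unit interval is bounded by the norms along vertical
  lines (using \<open>x \<le> 1 + x\<^sup>2\<close>), with a bound that does not depend on \<open>N\<close>. So some height
  in each unit interval is good. The segment is parametrised by \<open>[0,1]\<close>, which is how contour integrals
  over line segments are defined.
\<close>

lemma quiet_heights:
  assumes cont: "continuous_on (half_plane c) h" and M: "M \<ge> 0" "\<And>s. c < s \<Longrightarrow> energy (\<lambda>t. h (Complex s t)) \<le> ennreal M"
    and ab: "c < a" "a \<le> b"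
  shows "\<exists>R\<in>{N..N+1}. (\<integral>\<^sup>+ x\<in>{0..1}. ennreal (cmod (h (Complex (a + x * (b - a)) R))) \<partial>lborel)
     + (\<integral>\<^sup>+ x\<in>{0..1}. ennreal (cmod (h (Complex (a + x * (b - a)) (- R)))) \<partial>lborel) \<le> ennreal (3 + 2 * M)"
proof -
  define H where "H z = (if z \<in> half_plane c then h z else 0)" for z
  have [measurable]: "H \<in> borel_measurable borel"
    using borel_measurable_continuous_on_if[OF _ cont, of "\<lambda>_. 0"] unfolding H_def by auto
  define p where "p x = a + x * (b - a)" for x
  have p: "c < p x" if "x \<in> {0..1}" for x
    using ab that by (auto simp: p_def intro: less_le_trans)
  have [measurable]: "p \<in> borel_measurable borel" unfolding p_def by measurable
  have Hh: "(\<integral>\<^sup>+ x\<in>{0..1}. ennreal (cmod (h (Complex (p x) r))) \<partial>lborel)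
     = (\<integral>\<^sup>+ x. ennreal (cmod (H (Complex (p x) r))) * indicator {0..1} x \<partial>lborel)" for r
    using p by (intro nn_integral_cong) (auto simp: H_def half_plane_def indicator_def)
  define J where "J r = (\<integral>\<^sup>+ x. ennreal (cmod (H (Complex (p x) r))) * indicator {0..1} x \<partial>lborel)" for r
  have [measurable]: "J \<in> borel_measurable borel" unfolding J_def by measurable
  have col: "(\<integral>\<^sup>+ r. ennreal (cmod (H (Complex (p x) (e * r)))) * indicator {N..N+1} r \<partial>lborel) \<le> ennreal (1 + M)"
    if x: "x \<in> {0..1}" and e: "\<bar>e\<bar> = 1" for x e :: real
  proof -
    have "(\<integral>\<^sup>+ r. ennreal (cmod (H (Complex (p x) (e * r)))) * indicator {N..N+1} r \<partial>lborel)
       \<le> (\<integral>\<^sup>+ r. indicator {N..N+1} r + ennreal ((cmod (h (Complex (p x) (0 + e * r))))\<^sup>2) \<partial>lborel)"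
    proof (intro nn_integral_mono)
      fix r :: real
      have 1: "y \<le> 1 + y\<^sup>2" if "y \<ge> 0" for y :: real
        using that sum_squares_bound[of y 1] unfolding power2_eq_square by linarith
      have 2: "ennreal y \<le> 1 + ennreal (y\<^sup>2)" if "y \<ge> 0" for y :: real
        using 1[OF that] that by (simp flip: ennreal_1 ennreal_plus)
      show "ennreal (cmod (H (Complex (p x) (e * r)))) * indicator {N..N+1} r
         \<le> indicator {N..N+1} r + ennreal ((cmod (h (Complex (p x) (0 + e * r))))\<^sup>2)"
        using p[OF x] 2[of "cmod (h (Complex (p x) (e * r)))"]
        by (auto simp: H_def half_plane_def indicator_def)
    qed
    also have "\<dots> = 1 + (\<integral>\<^sup>+ r. ennreal ((cmod (h (Complex (p x) (0 + e * r))))\<^sup>2) \<partial>lborel)"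
      using borel_measurable_line[OF cont p[OF x]]
      by (subst nn_integral_add) auto
    also have "(\<integral>\<^sup>+ r. ennreal ((cmod (h (Complex (p x) (0 + e * r))))\<^sup>2) \<partial>lborel) = energy (\<lambda>t. h (Complex (p x) t))"
      unfolding energy_def using e borel_measurable_line[OF cont p[OF x]]
      by (subst nn_integral_real_affine[where c = e and t = 0]) auto
    also have "1 + energy (\<lambda>t. h (Complex (p x) t)) \<le> 1 + ennreal M"
      using M(2)[OF p[OF x]] by (intro add_mono) auto
    finally show ?thesis using M(1) by (simp add: ennreal_plus)
  qed
  have bound: "(\<integral>\<^sup>+ r. J (e * r) * indicator {N..N+1} r \<partial>lborel) \<le> ennreal (1 + M)" if e: "\<bar>e\<bar> = 1" for e
  proof -
    have "(\<integral>\<^sup>+ r. J (e * r) * indicator {N..N+1} r \<partial>lborel)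
      = (\<integral>\<^sup>+ r. \<integral>\<^sup>+ x. ennreal (cmod (H (Complex (p x) (e * r)))) * indicator {0..1} x * indicator {N..N+1} r \<partial>lborel \<partial>lborel)"
      unfolding J_def by (subst nn_integral_multc) auto
    also have "\<dots> = (\<integral>\<^sup>+ x. \<integral>\<^sup>+ r. ennreal (cmod (H (Complex (p x) (e * r)))) * indicator {0..1} x * indicator {N..N+1} r \<partial>lborel \<partial>lborel)"
      by (rule lborel_pair.Fubini') measurable
    also have "\<dots> = (\<integral>\<^sup>+ x. indicator {0..1} x * (\<integral>\<^sup>+ r. ennreal (cmod (H (Complex (p x) (e * r)))) * indicator {N..N+1} r \<partial>lborel) \<partial>lborel)"
      by (subst nn_integral_cmult[symmetric]) (auto simp: mult_ac)
    also have "\<dots> \<le> (\<integral>\<^sup>+ x. indicator {0..1::real} x * ennreal (1 + M) \<partial>lborel)"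
      using col[OF _ e] by (intro nn_integral_mono) (auto simp: indicator_def)
    also have "\<dots> = ennreal (1 + M)"
      by (subst nn_integral_multc) auto
    finally show ?thesis .
  qed
  \<comment> \<open>The mean over the unit interval is at most \<open>2 + 2 * M\<close>, which is strictly below the constant claimed.\<close>
  have "\<exists>R\<in>{N..N+1}. J R + J (- R) \<le> ennreal (3 + 2 * M)"
  proof (rule ccontr)
    assume "\<not> ?thesis"
    then have big: "ennreal (3 + 2 * M) \<le> J R + J (- R)" if "R \<in> {N..N+1}" for R
      using that by force
    have "ennreal (3 + 2 * M) = (\<integral>\<^sup>+ r. ennreal (3 + 2 * M) * indicator {N..N+1} r \<partial>lborel)"
      by (subst nn_integral_cmult_indicator) auto
    also have "\<dots> \<le> (\<integral>\<^sup>+ r. J (1 * r) * indicator {N..N+1} r + J ((-1) * r) * indicator {N..N+1} r \<partial>lborel)"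
      using big by (intro nn_integral_mono) (auto simp: indicator_def)
    also have "\<dots> = (\<integral>\<^sup>+ r. J (1 * r) * indicator {N..N+1} r \<partial>lborel) + (\<integral>\<^sup>+ r. J ((-1) * r) * indicator {N..N+1} r \<partial>lborel)"
      by (intro nn_integral_add) auto
    also have "\<dots> \<le> ennreal (1 + M) + ennreal (1 + M)"
      by (intro add_mono bound) auto
    also have "\<dots> = ennreal (2 + 2 * M)"
      using M(1) by (subst ennreal_plus[symmetric]) auto
    finally show False using M(1) by simp
  qed
  then show ?thesis unfolding p_def[symmetric] Hh J_def by simp
qed

text \<open>
  Only the mean of \<open>|h|\<close> over the segment is under control in the application, not its supremum.
\<close>

lemma contour_integral_horizontal_le:
  assumes cont: "continuous_on (closed_segment (Complex a r) (Complex b r)) F"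
    and conth: "continuous_on (closed_segment (Complex a r) (Complex b r)) h"
    and le: "\<And>x. x \<in> {0..1} \<Longrightarrow> cmod (F (Complex (a + x * (b - a)) r)) \<le> B * cmod (h (Complex (a + x * (b - a)) r))"
    and J: "(\<integral>\<^sup>+ x\<in>{0..1}. ennreal (cmod (h (Complex (a + x * (b - a)) r))) \<partial>lborel) \<le> ennreal J"
    and pos: "a \<le> b" "B \<ge> 0" "J \<ge> 0"
  shows "cmod (contour_integral (linepath (Complex a r) (Complex b r)) F) \<le> (b - a) * B * J"
proof -
  define G where "G x = F (Complex (a + x * (b - a)) r)" for x
  have lp: "linepath (Complex a r) (Complex b r) x = Complex (a + x * (b - a)) r" for x
    by (simp add: linepath_def complex_eq_iff algebra_simps)
  have "continuous_on {0..1} (\<lambda>x. F (linepath (Complex a r) (Complex b r) x))"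
    using cont by (intro continuous_on_compose2[OF cont] continuous_on_linepath) (auto simp: linepath_in_path)
  then have contG: "continuous_on {0..1} G" by (simp add: lp G_def[abs_def])
  have "continuous_on {0..1} (\<lambda>x. h (linepath (Complex a r) (Complex b r) x))"
    using conth by (intro continuous_on_compose2[OF conth] continuous_on_linepath) (auto simp: linepath_in_path)
  then have contH: "continuous_on {0..1} (\<lambda>x. h (Complex (a + x * (b - a)) r))" by (simp add: lp)
  have int: "set_integrable lborel {0..1} G"
    unfolding set_integrable_def by (intro borel_integrable_compact contG) auto
  have "contour_integral (linepath (Complex a r) (Complex b r)) F = complex_of_real (b - a) * integral {0..1} G"
  proof -
    have "Complex b r - Complex a r = complex_of_real (b - a)" by (simp add: complex_eq_iff)
    then show ?thesis
      unfolding contour_integral_integral by (simp add: lp G_def[abs_def] mult.commute)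
  qed
  also have "integral {0..1} G = (LINT x:{0..1}|lborel. G x)"
    using set_borel_integral_eq_integral(2)[OF int] by simp
  finally have "cmod (contour_integral (linepath (Complex a r) (Complex b r)) F) = (b - a) * cmod (LINT x:{0..1}|lborel. G x)"
    using pos by (simp only: norm_mult norm_of_real)
  moreover have "cmod (LINT x:{0..1}|lborel. G x) \<le> B * J"
  proof -
    have "ennreal (cmod (LINT x:{0..1}|lborel. G x)) \<le> (\<integral>\<^sup>+ x. norm (indicator {0..1} x *\<^sub>R G x) \<partial>lborel)"
      unfolding set_lebesgue_integral_def using int
      by (intro integral_norm_bound_ennreal) (auto simp: set_integrable_def)
    also have "\<dots> \<le> (\<integral>\<^sup>+ x. ennreal B * (ennreal (cmod (h (Complex (a + x * (b - a)) r))) * indicator {0..1} x) \<partial>lborel)"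
      using le pos by (intro nn_integral_mono) (auto simp: G_def indicator_def simp flip: ennreal_mult')
    also have "\<dots> \<le> ennreal B * ennreal J"
    proof -
      have "(\<lambda>x. indicator {0..1} x *\<^sub>R h (Complex (a + x * (b - a)) r)) \<in> borel_measurable borel"
        using contH by (intro borel_measurable_continuous_on_indicator) auto
      then have "(\<lambda>x. ennreal (cmod (indicator {0..1} x *\<^sub>R h (Complex (a + x * (b - a)) r)))) \<in> borel_measurable borel"
        by measurable
      also have "(\<lambda>x. ennreal (cmod (indicator {0..1} x *\<^sub>R h (Complex (a + x * (b - a)) r))))
         = (\<lambda>x. ennreal (cmod (h (Complex (a + x * (b - a)) r))) * indicator {0..1} x)"
        by (auto simp: indicator_def)
      finally show ?thesis using J by (subst nn_integral_cmult) (auto intro: mult_left_mono)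
    qed
    finally show ?thesis using pos by (simp flip: ennreal_mult)
  qed
  ultimately show ?thesis using pos by (simp add: mult.assoc mult_left_mono)
qed

lemma integral_interval_eq:
  fixes F :: "real \<Rightarrow> complex"
  assumes "continuous_on UNIV F"
  shows "integral {a..b} F = (LINT t|lborel. indicator {a..b} t *\<^sub>R F t)"
proof -
  have "set_integrable lborel {a..b} F"
    unfolding set_integrable_def
    by (intro borel_integrable_compact continuous_on_subset[OF assms]) auto
  from set_borel_integral_eq_integral(2)[OF this] show ?thesis
    by (simp add: set_lebesgue_integral_def)
qed

text \<open>
  Cauchy's integral formula on the rectangle with corners \<open>a - iR\<close> and \<open>b + iR\<close>. On the horizontal
  sides at the heights of \<open>quiet_heights\<close> the kernel is at most \<open>1 / (N - |Im z|)\<close>, which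
  makes their contribution vanish as \<open>N\<close> grows.
\<close>

lemma rectangle_Cauchy_bound:
  fixes h :: "complex \<Rightarrow> complex"
  assumes hol: "h holomorphic_on half_plane c" and M: "M \<ge> 0" "\<And>s. c < s \<Longrightarrow> energy (\<lambda>t. h (Complex s t)) \<le> ennreal M"
    and ab: "c < a" "a < Re z" "Re z < b" and N: "N > \<bar>Im z\<bar>"
  shows "\<exists>R\<in>{N..N+1}. cmod (2 * pi * h z
         - ((LINT t|lborel. indicator {-R..R} t *\<^sub>R (h (Complex b t) / (Complex b t - z)))
          - (LINT t|lborel. indicator {-R..R} t *\<^sub>R (h (Complex a t) / (Complex a t - z)))))
       \<le> 2 * (b - a) * (3 + 2 * M) / (N - \<bar>Im z\<bar>)"
proof -
  have cont: "continuous_on (half_plane c) h"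
    using hol by (rule holomorphic_on_imp_continuous_on)
  define F where "F w = h w / (w - z)" for w
  have contF: "continuous_on (half_plane c - {z}) F"
    unfolding F_def by (intro continuous_intros continuous_on_subset[OF cont]) auto
  obtain R where R: "R \<in> {N..N+1}"
    and J: "(\<integral>\<^sup>+ x\<in>{0..1}. ennreal (cmod (h (Complex (a + x * (b - a)) R))) \<partial>lborel)
     + (\<integral>\<^sup>+ x\<in>{0..1}. ennreal (cmod (h (Complex (a + x * (b - a)) (- R)))) \<partial>lborel) \<le> ennreal (3 + 2 * M)"
    using quiet_heights[OF cont M ab(1), of b N] ab by auto
  have J': "(\<integral>\<^sup>+ x\<in>{0..1}. ennreal (cmod (h (Complex (a + x * (b - a)) R))) \<partial>lborel) \<le> ennreal (3 + 2 * M)"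
     "(\<integral>\<^sup>+ x\<in>{0..1}. ennreal (cmod (h (Complex (a + x * (b - a)) (- R)))) \<partial>lborel) \<le> ennreal (3 + 2 * M)"
    using order_trans[OF _ J] by (auto simp: add_increasing add_increasing2)
  have Rz: "R > \<bar>Im z\<bar>" using R N by auto
  define a1 a2 a3 a4 where "a1 = Complex a (-R)" and "a2 = Complex b (-R)" and "a3 = Complex b R" and "a4 = Complex a R"
  have segs: "closed_segment a1 a2 \<subseteq> half_plane c - {z}" "closed_segment a2 a3 \<subseteq> half_plane c - {z}"
     "closed_segment a3 a4 \<subseteq> half_plane c - {z}" "closed_segment a4 a1 \<subseteq> half_plane c - {z}"
     "closed_segment a4 a3 \<subseteq> half_plane c - {z}"
    using ab Rz unfolding a1_def a2_def a3_def a4_def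
    by (auto simp: closed_segment_same_Re closed_segment_same_Im half_plane_def closed_segment_eq_real_ivl split: if_splits)
  have rect: "rectpath a1 a3 = linepath a1 a2 +++ linepath a2 a3 +++ linepath a3 a4 +++ linepath a4 a1"
    by (simp add: rectpath_def Let_def a1_def a2_def a3_def a4_def)
  have img: "path_image (rectpath a1 a3) \<subseteq> half_plane c - {z}"
    unfolding rect using segs by (simp add: path_image_join)
  have "convex (half_plane c)"
    unfolding half_plane_def by (rule convex_halfspace_Re_gt)
  moreover have "z \<in> interior (half_plane c)"
    using ab by (simp add: interior_open) (simp add: half_plane_def)
  moreover have "winding_number (rectpath a1 a3) z = 1"
    using ab Rz by (intro winding_number_rectpath) (auto simp: in_box_complex_iff a1_def a3_def)
  ultimately have cif: "(F has_contour_integral (2 * pi * \<i> * h z)) (rectpath a1 a3)"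
    using Cauchy_integral_formula_convex_simple[OF _ hol _ valid_path_rectpath img]
    by (simp add: F_def[abs_def])
  have ci: "F contour_integrable_on linepath a1 a2" "F contour_integrable_on linepath a2 a3"
      "F contour_integrable_on linepath a3 a4" "F contour_integrable_on linepath a4 a1"
    by (intro contour_integrable_continuous_linepath continuous_on_subset[OF contF] segs)+
  have sum: "2 * pi * \<i> * h z = contour_integral (linepath a1 a2) F + contour_integral (linepath a2 a3) F
      + contour_integral (linepath a3 a4) F + contour_integral (linepath a4 a1) F"
    using contour_integral_unique[OF cif] unfolding rect using ci by (simp add: add.assoc)
  have vert: "integral {-R..R} (\<lambda>t. F (Complex s t)) = (LINT t|lborel. indicator {-R..R} t *\<^sub>R F (Complex s t))"
    if "c < s" "s \<noteq> Re z" for s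
    using that unfolding Complex_eq
    by (intro integral_interval_eq continuous_on_compose2[OF contF] continuous_intros)
       (auto simp: half_plane_def)
  have right: "contour_integral (linepath a2 a3) F = \<i> * (LINT t|lborel. indicator {-R..R} t *\<^sub>R F (Complex b t))"
    using ab Rz by (subst vert[symmetric]) (auto simp: a2_def a3_def intro!: contour_integral_linepath_same_Re)
  have "contour_integral (linepath a1 a4) F = \<i> * (LINT t|lborel. indicator {-R..R} t *\<^sub>R F (Complex a t))"
    using ab Rz by (subst vert[symmetric]) (auto simp: a1_def a4_def intro!: contour_integral_linepath_same_Re)
  moreover have "contour_integral (linepath a4 a1) F = - contour_integral (linepath a1 a4) F"
    by (intro contour_integral_reverse_linepath continuous_on_subset[OF contF] segs)
  ultimately have left: "contour_integral (linepath a4 a1) F = - (\<i> * (LINT t|lborel. indicator {-R..R} t *\<^sub>R F (Complex a t)))"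
    by simp
  have hor: "cmod (contour_integral (linepath (Complex a r) (Complex b r)) F) \<le> (b - a) * (1 / (N - \<bar>Im z\<bar>)) * (3 + 2 * M)"
    if r: "\<bar>r\<bar> = R" 
      and seg: "closed_segment (Complex a r) (Complex b r) \<subseteq> half_plane c - {z}"
      and Jr: "(\<integral>\<^sup>+ x\<in>{0..1}. ennreal (cmod (h (Complex (a + x * (b - a)) r))) \<partial>lborel) \<le> ennreal (3 + 2 * M)" for r
  proof (rule contour_integral_horizontal_le[OF _ _ _ Jr])
    show "cmod (F (Complex (a + x * (b - a)) r)) \<le> 1 / (N - \<bar>Im z\<bar>) * cmod (h (Complex (a + x * (b - a)) r))" for x
    proof -
      have "N - \<bar>Im z\<bar> \<le> \<bar>Im (Complex (a + x * (b - a)) r - z)\<bar>" using R r by auto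
      also have "\<dots> \<le> cmod (Complex (a + x * (b - a)) r - z)" by (rule abs_Im_le_cmod)
      finally have le: "N - \<bar>Im z\<bar> \<le> cmod (Complex (a + x * (b - a)) r - z)" .
      have "0 < N - \<bar>Im z\<bar>" using N by simp
      then have "cmod (h (Complex (a + x * (b - a)) r)) / cmod (Complex (a + x * (b - a)) r - z)
          \<le> cmod (h (Complex (a + x * (b - a)) r)) / (N - \<bar>Im z\<bar>)"
        using le by (intro divide_left_mono mult_pos_pos) auto
      then show ?thesis by (simp add: F_def norm_divide)
    qed
    show "continuous_on (closed_segment (Complex a r) (Complex b r)) F"
      using seg by (rule continuous_on_subset[OF contF])
    show "continuous_on (closed_segment (Complex a r) (Complex b r)) h"
      using seg by (intro continuous_on_subset[OF cont]) auto
  qed (use ab N M in auto)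
  have bot: "cmod (contour_integral (linepath a1 a2) F) \<le> (b - a) * (1 / (N - \<bar>Im z\<bar>)) * (3 + 2 * M)"
    using hor[of "-R"] J'(2) segs(1) Rz by (simp add: a1_def a2_def)
  have "cmod (contour_integral (linepath a4 a3) F) \<le> (b - a) * (1 / (N - \<bar>Im z\<bar>)) * (3 + 2 * M)"
    using hor[of R] J'(1) segs(5) Rz by (simp add: a4_def a3_def)
  moreover have "contour_integral (linepath a3 a4) F = - contour_integral (linepath a4 a3) F"
    by (intro contour_integral_reverse_linepath continuous_on_subset[OF contF] segs)
  ultimately have top: "cmod (contour_integral (linepath a3 a4) F) \<le> (b - a) * (1 / (N - \<bar>Im z\<bar>)) * (3 + 2 * M)"
    by simp
  define X where "X = 2 * pi * h z
         - ((LINT t|lborel. indicator {-R..R} t *\<^sub>R F (Complex b t)) - (LINT t|lborel. indicator {-R..R} t *\<^sub>R F (Complex a t)))"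
  have "\<i> * X = contour_integral (linepath a1 a2) F + contour_integral (linepath a3 a4) F"
    using sum unfolding X_def right left by (simp add: algebra_simps)
  then have "cmod X = cmod (contour_integral (linepath a1 a2) F + contour_integral (linepath a3 a4) F)"
    by (metis mult_1 norm_ii norm_mult)
  also have "\<dots> \<le> cmod (contour_integral (linepath a1 a2) F) + cmod (contour_integral (linepath a3 a4) F)"
    by (rule norm_triangle_ineq)
  also have "\<dots> \<le> (b - a) * (1 / (N - \<bar>Im z\<bar>)) * (3 + 2 * M) + (b - a) * (1 / (N - \<bar>Im z\<bar>)) * (3 + 2 * M)"
    by (intro add_mono bot top)
  also have "\<dots> = 2 * (b - a) * (3 + 2 * M) / (N - \<bar>Im z\<bar>)"
    by simp
  finally show ?thesis
    using R unfolding X_def F_def by blast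
qed

text \<open>
  First the height of the rectangle tends to infinity, then its right-hand side. By Cauchy-Schwarz
  the integral over the line \<open>Re w = b\<close> decays like \<open>1 / sqrt b\<close>, because the norm of \<open>h\<close> is bounded
  uniformly over all lines.
\<close>

theorem half_plane_Cauchy_formula:
  fixes h :: "complex \<Rightarrow> complex"
  assumes hol: "h holomorphic_on half_plane c" and M: "M \<ge> 0" "\<And>s. c < s \<Longrightarrow> energy (\<lambda>t. h (Complex s t)) \<le> ennreal M"
    and a: "c < a" "a < Re z"
  shows "2 * pi * h z = (LINT t|lborel. h (Complex a t) * (1 / (z - Complex a t)))"
proof -
  have cont: "continuous_on (half_plane c) h"
    using hol by (rule holomorphic_on_imp_continuous_on)
  define K where "K s = (LINT t|lborel. h (Complex s t) * (1 / (Complex s t - z)))" for s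
  have meas: "(\<lambda>t. h (Complex s t)) \<in> borel_measurable borel" "(\<lambda>t. 1 / (Complex s t - z)) \<in> borel_measurable borel"
    if "c < s" for s
    using borel_measurable_line[OF cont that] by auto
  have fin: "energy (\<lambda>t. h (Complex s t)) < \<infinity>" if "c < s" for s
    using M(2)[OF that] by (auto intro: le_less_trans)
  have kfin: "energy (\<lambda>t. 1 / (Complex s t - z)) < \<infinity>" if "s \<noteq> Re z" for s
    using that by (simp add: energy_Cauchy_kernel)
  have int: "integrable lborel (\<lambda>t. h (Complex s t) * (1 / (Complex s t - z)))" if "c < s" "s \<noteq> Re z" for s
    using that by (intro integrable_mult_energy meas fin kfin)
  have Keq: "2 * pi * h z = K b - K a" if b: "Re z < b" for b
  proof -
    define N where "N n = \<bar>Im z\<bar> + 1 + real n" for n :: nat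
    define Q where "Q s r = (LINT t|lborel. indicator {-r..r} t *\<^sub>R (h (Complex s t) / (Complex s t - z)))" for s r
    have "\<exists>R. \<forall>n. R n \<in> {N n..N n + 1} \<and>
        cmod (2 * pi * h z - (Q b (R n) - Q a (R n))) \<le> 2 * (b - a) * (3 + 2 * M) / (N n - \<bar>Im z\<bar>)"
    proof (intro choice allI)
      fix n
      have "\<bar>Im z\<bar> < N n" by (simp add: N_def)
      from rectangle_Cauchy_bound[OF hol M a b this]
      show "\<exists>r. r \<in> {N n..N n + 1} \<and>
        cmod (2 * pi * h z - (Q b r - Q a r)) \<le> 2 * (b - a) * (3 + 2 * M) / (N n - \<bar>Im z\<bar>)"
        unfolding Q_def by blast
    qed
    then obtain R where R: "\<And>n. R n \<in> {N n..N n + 1}"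
      and le: "\<And>n. cmod (2 * pi * h z - (Q b (R n) - Q a (R n))) \<le> 2 * (b - a) * (3 + 2 * M) / (N n - \<bar>Im z\<bar>)"
      by blast
    have lim: "(\<lambda>n. Q s (R n)) \<longlonglongrightarrow> K s"
      if s: "c < s" "s \<noteq> Re z" for s
      unfolding K_def Q_def
    proof (rule integral_dominated_convergence)
      have [measurable]: "(\<lambda>t. h (Complex s t)) \<in> borel_measurable borel"
        using meas s by auto
      show "(\<lambda>t. h (Complex s t) * (1 / (Complex s t - z))) \<in> borel_measurable lborel"
        using int[OF s] by auto
      show "(\<lambda>t. indicator {-R n..R n} t *\<^sub>R (h (Complex s t) / (Complex s t - z))) \<in> borel_measurable lborel" for n
        by measurable
      show "integrable lborel (\<lambda>t. cmod (h (Complex s t) * (1 / (Complex s t - z))))"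
        using int[OF s] by auto
      show "AE t in lborel. (\<lambda>n. indicator {-R n..R n} t *\<^sub>R (h (Complex s t) / (Complex s t - z))) \<longlonglongrightarrow> h (Complex s t) * (1 / (Complex s t - z))"
      proof (intro AE_I2 tendsto_eventually)
        fix t
        show "\<forall>\<^sub>F n in sequentially. indicator {-R n..R n} t *\<^sub>R (h (Complex s t) / (Complex s t - z)) = h (Complex s t) * (1 / (Complex s t - z))"
          using eventually_ge_at_top[of "nat \<lceil>\<bar>t\<bar>\<rceil>"]
        proof eventually_elim
          case (elim n)
          then have "\<bar>t\<bar> \<le> real n" by linarith
          then have "\<bar>t\<bar> \<le> R n" using R[of n] abs_ge_zero[of "Im z"] unfolding N_def atLeastAtMost_iff by linarith
          then show ?case by (auto simp: indicator_def)
        qed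
      qed
    qed (auto simp: indicator_def norm_mult norm_divide)
    have bz: "c < b" "b \<noteq> Re z" and az: "a \<noteq> Re z" using a b by auto
    have "(\<lambda>n. 2 * pi * h z
         - (Q b (R n) - Q a (R n)))
       \<longlonglongrightarrow> 2 * pi * h z - (K b - K a)"
      by (intro tendsto_intros lim bz a(1) az)
    moreover have "(\<lambda>n. 2 * pi * h z
         - (Q b (R n) - Q a (R n)))
       \<longlonglongrightarrow> 0"
    proof (rule Lim_null_comparison)
      show "\<forall>\<^sub>F n in sequentially. cmod (2 * pi * h z
         - (Q b (R n) - Q a (R n)))
         \<le> 2 * (b - a) * (3 + 2 * M) * inverse (real (Suc n))"
        using le by (auto simp: N_def field_simps)
      show "(\<lambda>n. 2 * (b - a) * (3 + 2 * M) * inverse (real (Suc n))) \<longlonglongrightarrow> 0"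
        by (intro tendsto_mult_right_zero LIMSEQ_inverse_real_of_nat)
    qed
    ultimately have "2 * pi * h z - (K b - K a) = 0" by (rule LIMSEQ_unique)
    then show ?thesis by simp
  qed
  have "(K \<longlongrightarrow> 0) at_top"
  proof (rule Lim_null_comparison)
    show "\<forall>\<^sub>F b in at_top. cmod (K b) \<le> sqrt (M * (pi / (b - Re z)))"
      using eventually_gt_at_top[of "Re z"]
    proof eventually_elim
      case (elim b)
      then have b: "c < b" "b \<noteq> Re z" using a by auto
      have "ennreal ((cmod (K b))\<^sup>2) \<le> energy (\<lambda>t. h (Complex b t)) * energy (\<lambda>t. 1 / (Complex b t - z))"
        unfolding K_def using b by (intro cmod_integral_mult_le meas fin kfin)
      also have "\<dots> \<le> ennreal M * ennreal (pi / (b - Re z))"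
        using M(2)[OF b(1)] elim by (simp add: energy_Cauchy_kernel[OF b(2)] mult_right_mono)
      finally have "(cmod (K b))\<^sup>2 \<le> M * (pi / (b - Re z))"
        using M(1) elim by (simp flip: ennreal_mult)
      then show ?case by (rule real_le_rsqrt)
    qed
    have "((\<lambda>b. sqrt (M * (pi / (b - Re z)))) \<longlongrightarrow> sqrt (M * 0)) at_top"
      by (intro tendsto_intros real_tendsto_divide_at_top[OF tendsto_const])
         real_asymp
    then show "((\<lambda>b. sqrt (M * (pi / (b - Re z)))) \<longlongrightarrow> 0) at_top" by simp
  qed
  moreover have ev: "\<forall>\<^sub>F b in at_top. K b = 2 * pi * h z + K a"
    using eventually_gt_at_top[of "Re z"] by eventually_elim (use Keq in \<open>simp add: algebra_simps\<close>)
  ultimately have "((\<lambda>b :: real. 2 * pi * h z + K a) \<longlongrightarrow> 0) at_top"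
    by (rule Lim_transform_eventually)
  then have "2 * pi * h z + K a = 0"
    by (simp add: tendsto_const_iff)
  then have "2 * pi * h z = - K a" by (simp add: eq_neg_iff_add_eq_0)
  also have "- K a = (LINT t|lborel. h (Complex a t) * (1 / (z - Complex a t)))"
    unfolding K_def
    by (subst Bochner_Integration.integral_minus[symmetric], intro Bochner_Integration.integral_cong refl)
       (metis minus_diff_eq minus_divide_right mult_minus_right)
  finally show ?thesis .
qed

section \<open>Lebesgue measurable functions and their Borel representatives\<close>

text \<open>
  The Fubini and Plancherel arguments need Borel functions, while the spaces consist of
  Lebesgue measurable ones.
\<close>

lemma borel_representative:
  fixes f :: "real \<Rightarrow> complex"
  assumes A: "A \<in> sets borel" and f: "f \<in> borel_measurable (lebesgue_on A)"
  shows "\<exists>F \<in> borel_measurable borel. (\<forall>x. x \<notin> A \<longrightarrow> F x = 0) \<and> (AE x in lebesgue_on A. f x = F x)"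
proof -
  have A': "A \<in> sets lebesgue" using A by auto
  define g where "g x = indicator A x *\<^sub>R f x" for x
  have g: "g \<in> borel_measurable lebesgue"
    using f A' unfolding g_def by (subst (asm) borel_measurable_restrict_space_iff) auto
  have "(\<lambda>x. Re (g x)) \<in> borel_measurable lebesgue" "(\<lambda>x. Im (g x)) \<in> borel_measurable lebesgue"
    using g by (auto intro: measurable_compose[OF _ borel_measurable_Re] measurable_compose[OF _ borel_measurable_Im])
  from this[THEN completion_ex_borel_measurable_real] obtain r i
    where [measurable]: "r \<in> borel_measurable borel" "i \<in> borel_measurable borel"
      and ri: "AE x in lborel. Re (g x) = r x" "AE x in lborel. Im (g x) = i x"
    by auto
  define F where "F x = indicator A x * Complex (r x) (i x)" for x
  have [measurable]: "F \<in> borel_measurable borel"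
    unfolding F_def using A by measurable
  have "AE x in lborel. x \<in> A \<longrightarrow> f x = F x"
    using ri by eventually_elim (auto simp: g_def F_def complex_eq_iff)
  then have "AE x in lebesgue_on A. f x = F x"
    using A' by (subst AE_restrict_space_iff) (auto intro: AE_completion)
  then show ?thesis
    by (intro bexI[of _ F]) (auto simp: F_def)
qed

lemma
  fixes p q :: "real \<Rightarrow> complex"
  assumes A: "A \<in> sets borel" and p[measurable]: "p \<in> borel_measurable borel" and p0: "\<And>x. x \<notin> A \<Longrightarrow> p x = 0"
    and q: "q \<in> borel_measurable (lebesgue_on A)" and eq: "AE x in lebesgue_on A. q x = p x"
  shows integral_lebesgue_on_eq_lborel: "integral\<^sup>L (lebesgue_on A) q = integral\<^sup>L lborel p"
    and integrable_lebesgue_on_iff_lborel: "integrable (lebesgue_on A) q \<longleftrightarrow> integrable lborel p"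
proof -
  have A': "A \<inter> space lebesgue \<in> sets lebesgue" using A by auto
  have p': "p \<in> borel_measurable (lebesgue_on A)"
    by (intro measurable_restrict_space1 measurable_completion) auto
  have ind: "(\<lambda>x. indicator A x *\<^sub>R p x) = p" using p0 by (auto simp: indicator_def)
  show "integral\<^sup>L (lebesgue_on A) q = integral\<^sup>L lborel p"
    using integral_cong_AE[OF q p' eq] by (simp add: integral_restrict_space[OF A'] ind integral_completion)
  show "integrable (lebesgue_on A) q \<longleftrightarrow> integrable lborel p"
    using integrable_cong_AE[OF q p' eq] by (simp add: integrable_restrict_space[OF A'] ind integrable_completion)
qed

lemma L2_sqnorm_eq_energy:
  assumes A: "A \<in> sets borel" and p[measurable]: "p \<in> borel_measurable borel" and p0: "\<And>x. x \<notin> A \<Longrightarrow> p x = 0"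
    and eq: "AE x in lebesgue_on A. q x = p x"
  shows "L2_sqnorm A q = energy p"
proof -
  have A': "A \<inter> space lebesgue \<in> sets lebesgue" using A by auto
  have "L2_sqnorm A q = (\<integral>\<^sup>+ x. ennreal ((cmod (p x))\<^sup>2) \<partial>lebesgue_on A)"
    unfolding L2_sqnorm_def using eq by (intro nn_integral_cong_AE) auto
  also have "\<dots> = (\<integral>\<^sup>+ x. ennreal ((cmod (p x))\<^sup>2) * indicator A x \<partial>lebesgue)"
    by (rule nn_integral_restrict_space[OF A'])
  also have "\<dots> = (\<integral>\<^sup>+ x. ennreal ((cmod (p x))\<^sup>2) \<partial>lebesgue)"
    using p0 by (intro nn_integral_cong) (auto simp: indicator_def)
  finally show ?thesis by (simp add: energy_def nn_integral_completion)
qed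

lemma L2_sqnorm_UNIV:
  assumes "p \<in> borel_measurable borel"
  shows "L2_sqnorm UNIV p = energy p"
  using assms by (intro L2_sqnorm_eq_energy) auto

section \<open>Exponentials on the half-line\<close>

lemma nn_integral_exp_halfline:
  assumes "a > 0"
  shows "(\<integral>\<^sup>+ x. ennreal (exp (- a * x)) * indicator {0..} x \<partial>lborel) = ennreal (1 / a)"
proof -
  have "(\<integral>\<^sup>+ x. ennreal (exp (- a * x)) * indicator {0..} x \<partial>lborel) = ennreal (0 - (- exp (- a * 0) / a))"
  proof (rule nn_integral_FTC_atLeast)
    show "((\<lambda>x. - exp (- a * x) / a) \<longlongrightarrow> 0) at_top"
      using assms by real_asymp
    show "((\<lambda>x. - exp (- a * x) / a) has_real_derivative exp (- a * x)) (at x)" for x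
      using assms by (auto intro!: derivative_eq_intros)
  qed auto
  then show ?thesis by simp
qed

definition exp_halfline :: "complex \<Rightarrow> real \<Rightarrow> complex" where
  "exp_halfline w x = indicator {0<..} x * exp (- w * complex_of_real x)"

lemma borel_measurable_exp_halfline [measurable]: "exp_halfline w \<in> borel_measurable borel"
  unfolding exp_halfline_def by measurable

lemma energy_exp_halfline:
  assumes "Re w > 0"
  shows "energy (exp_halfline w) < \<infinity>"
proof -
  have "energy (exp_halfline w) \<le> (\<integral>\<^sup>+ x. ennreal (exp (- (2 * Re w) * x)) * indicator {0..} x \<partial>lborel)"
    unfolding energy_def exp_halfline_def
    by (intro nn_integral_mono)
       (auto simp: indicator_def norm_mult power2_eq_square simp flip: exp_add)
  also have "\<dots> < \<infinity>"
    using assms by (subst nn_integral_exp_halfline) auto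
  finally show ?thesis .
qed

lemma integrable_exp_halfline:
  assumes "Re w > 0"
  shows "integrable lborel (exp_halfline w)"
proof -
  have "(\<integral>\<^sup>+ x. norm (exp_halfline w x) \<partial>lborel) \<le> (\<integral>\<^sup>+ x. ennreal (exp (- Re w * x)) * indicator {0..} x \<partial>lborel)"
    unfolding exp_halfline_def
    by (intro nn_integral_mono) (auto simp: indicator_def norm_mult)
  also have "\<dots> < \<infinity>"
    using assms by (subst nn_integral_exp_halfline) auto
  finally show ?thesis unfolding integrable_iff_bounded by auto
qed

lemma integral_exp_halfline:
  assumes "Re w > 0"
  shows "(LINT x|lborel. exp_halfline w x) = 1 / w"
proof -
  have w: "w \<noteq> 0" using assms by auto
  have ei: "einterval 0 \<infinity> = {0<..}"
    by (auto simp: einterval_def)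
  have "(LBINT x=0..\<infinity>. exp (- w * complex_of_real x)) = 0 - (- (1 / w))"
  proof (rule interval_integral_FTC_integrable)
    show "((\<lambda>x. - exp (- w * complex_of_real x) / w) has_vector_derivative exp (- w * complex_of_real x)) (at x)" for x
    proof -
      have "((\<lambda>z. - exp (- w * z) / w) has_field_derivative exp (- w * of_real x)) (at (of_real x))"
        using w by (auto intro!: derivative_eq_intros)
      then show ?thesis by (rule has_vector_derivative_real_field)
    qed
    show "isCont (\<lambda>x. exp (- w * complex_of_real x)) x" for x by (intro continuous_intros)
    show "set_integrable lborel (einterval 0 \<infinity>) (\<lambda>x. exp (- w * complex_of_real x))"
      using integrable_exp_halfline[OF assms] unfolding set_integrable_def ei
      by (simp add: exp_halfline_def[abs_def] scaleR_conv_of_real of_real_indicator)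
    have "isCont (\<lambda>x. - exp (- w * complex_of_real x) / w) 0"
      using w by (intro continuous_intros) auto
    then have "((\<lambda>x. - exp (- w * complex_of_real x) / w) \<longlongrightarrow> - (1 / w)) (at 0)"
      by (simp add: isCont_def)
    then show "(((\<lambda>x. - exp (- w * complex_of_real x) / w) \<circ> real_of_ereal) \<longlongrightarrow> - (1 / w)) (at_right 0)"
      unfolding zero_ereal_def ereal_tendsto_simps by (rule filterlim_mono) (auto simp: at_le)
    have "((\<lambda>x. - exp (- w * complex_of_real x) / w) \<longlongrightarrow> 0) at_top"
    proof (rule Lim_null_comparison)
      show "\<forall>\<^sub>F x in at_top. cmod (- exp (- w * complex_of_real x) / w) \<le> exp (- Re w * x) / cmod w"
        by (simp add: norm_divide)
      show "((\<lambda>x. exp (- Re w * x) / cmod w) \<longlongrightarrow> 0) at_top"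
        using assms w by real_asymp
    qed
    then show "(((\<lambda>x. - exp (- w * complex_of_real x) / w) \<circ> real_of_ereal) \<longlongrightarrow> 0) (at_left \<infinity>)"
      unfolding ereal_tendsto_simps .
  qed auto
  moreover have "(LBINT x=0..\<infinity>. exp (- w * complex_of_real x)) = (LINT x|lborel. exp_halfline w x)"
    by (simp add: interval_lebesgue_integral_def set_lebesgue_integral_def ei exp_halfline_def scaleR_conv_of_real of_real_indicator)
  ultimately show ?thesis by simp
qed

section \<open>Laplace transforms of causal functions\<close>

text \<open>
  Functions on the half-line \<open>(0,\<infinity>)\<close> are treated as functions on the line that vanish elsewhere. The
  name is that of signal processing.
\<close>

definition causal :: "(real \<Rightarrow> complex) \<Rightarrow> bool" where
  "causal F \<longleftrightarrow> (\<forall>x\<le>0. F x = 0)"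

lemma causalD: "causal F \<Longrightarrow> x \<le> 0 \<Longrightarrow> F x = 0"
  by (simp add: causal_def)

lemma borel_measurable_weighted [measurable]:
  assumes [measurable]: "F \<in> borel_measurable borel"
  shows "weighted s F \<in> borel_measurable borel"
  unfolding weighted_def[abs_def] by measurable

text \<open>
  For \<open>s > c\<close> the weight gains a decaying exponential that is itself in \<open>L\<^sup>2\<close>. So if
  \<open>weighted c F\<close> is square-integrable, then \<open>weighted s F\<close> is a product of two square-integrable
  functions and hence integrable.
\<close>

lemma weighted_shift:
  assumes F0: "causal F"
  shows "weighted s F = (\<lambda>x. exp_halfline (complex_of_real (s - c)) x * weighted c F x)"
proof
  fix x
  have "exp (- s * x) = exp (- (s - c) * x) * exp (- c * x)"
    by (simp add: algebra_simps flip: exp_add)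
  then have "complex_of_real (exp (- s * x)) = exp (- complex_of_real (s - c) * complex_of_real x) * complex_of_real (exp (- c * x))"
    by (simp flip: exp_of_real)
  then show "weighted s F x = exp_halfline (complex_of_real (s - c)) x * weighted c F x"
    using causalD[OF F0, of x] by (cases "x \<le> 0") (auto simp: weighted_def exp_halfline_def)
qed

lemma energy_weighted_antimono:
  assumes "causal F" "c \<le> s"
  shows "energy (weighted s F) \<le> energy (weighted c F)"
proof (rule energy_mono)
  fix x show "cmod (weighted s F x) \<le> cmod (weighted c F x)"
    using causalD[OF assms(1), of x] assms(2)
    by (cases "x \<le> 0") (auto simp: weighted_def norm_mult intro!: mult_right_mono)
qed

lemma integrable_weighted:
  assumes [measurable]: "F \<in> borel_measurable borel" and F0: "causal F"
    and fin: "energy (weighted c F) < \<infinity>" and s: "c < s"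
  shows "integrable lborel (weighted s F)"
proof (subst weighted_shift[where c = c])
  show "integrable lborel (\<lambda>x. exp_halfline (complex_of_real (s - c)) x * weighted c F x)"
    using s by (intro integrable_mult_energy energy_exp_halfline fin) auto
qed (rule F0)

text \<open>
  Monotone convergence as \<open>s\<close> decreases to \<open>c\<close>. It identifies the supremum in the Hardy norm, and it
  shows that the inverse transform of a Hardy function lies in the weighted space.
\<close>

lemma energy_weighted_le:
  assumes [measurable]: "F \<in> borel_measurable borel" and F0: "causal F"
    and le: "\<And>s. c < s \<Longrightarrow> energy (weighted s F) \<le> B"
  shows "energy (weighted c F) \<le> B"
proof (rule LIMSEQ_le_const2)
  define s where "s n = c + inverse (real (Suc n))" for n
  show "(\<lambda>n. energy (weighted (s n) F)) \<longlonglongrightarrow> energy (weighted c F)"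
    unfolding energy_def
  proof (rule nn_integral_LIMSEQ)
    show "incseq (\<lambda>n x. ennreal ((cmod (weighted (s n) F x))\<^sup>2))"
    proof (intro incseq_SucI le_funI ennreal_leI power_mono)
      fix n x
      have "s (Suc n) \<le> s n" by (simp add: s_def field_simps)
      then show "cmod (weighted (s n) F x) \<le> cmod (weighted (s (Suc n)) F x)"
        using causalD[OF F0, of x] by (cases "x \<le> 0") (auto simp: weighted_def norm_mult intro!: mult_right_mono)
    qed auto
    fix x
    have "s \<longlonglongrightarrow> c"
      using tendsto_add[OF tendsto_const LIMSEQ_inverse_real_of_nat] by (simp add: s_def[abs_def])
    then have "(\<lambda>n. (cmod (weighted (s n) F x))\<^sup>2) \<longlonglongrightarrow> (cmod (weighted c F x))\<^sup>2"
      unfolding weighted_def by (intro tendsto_intros)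
    then show "(\<lambda>n. ennreal ((cmod (weighted (s n) F x))\<^sup>2)) \<longlonglongrightarrow> ennreal ((cmod (weighted c F x))\<^sup>2)"
      by (rule tendsto_ennrealI)
  qed measurable
  show "\<exists>N. \<forall>n\<ge>N. energy (weighted (s n) F) \<le> B"
    by (intro exI allI impI le) (simp add: s_def)
qed

lemma laplace_kernel_eq:
  "exp (- z * complex_of_real x) * F x
    = exp (- \<i> * complex_of_real (Im z) * complex_of_real x) * weighted (Re z) F x"
proof -
  have "- z * complex_of_real x = - \<i> * complex_of_real (Im z) * complex_of_real x + complex_of_real (- Re z * x)"
    by (simp add: complex_eq_iff)
  then have "exp (- z * complex_of_real x) = exp (- \<i> * complex_of_real (Im z) * complex_of_real x) * complex_of_real (exp (- Re z * x))"
    by (simp only: exp_add exp_of_real)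
  then show ?thesis by (simp add: weighted_def)
qed

lemma
  assumes [measurable]: "F \<in> borel_measurable borel" and F0: "causal F"
    and f: "f \<in> borel_measurable (lebesgue_on {0<..})" and eq: "AE x in lebesgue_on {0<..}. f x = F x"
  shows laplace_eq_fourier: "laplace f z = fourier (weighted (Re z) F) (Im z)"
    and laplace_integrable_iff:
      "integrable (lebesgue_on {0<..}) (\<lambda>\<tau>. exp (- z * complex_of_real \<tau>) * f \<tau>)
        \<longleftrightarrow> integrable lborel (\<lambda>\<tau>. exp (- z * complex_of_real \<tau>) * F \<tau>)"
proof -
  have exp: "(\<lambda>x. exp (- z * complex_of_real x)) \<in> borel_measurable (lebesgue_on {0<..})"
    by (intro measurable_restrict_space1 measurable_completion) measurable
  have m: "(\<lambda>\<tau>. exp (- z * complex_of_real \<tau>) * f \<tau>) \<in> borel_measurable (lebesgue_on {0<..})"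
    by (intro borel_measurable_times exp f)
  have ae: "AE \<tau> in lebesgue_on {0<..}. exp (- z * complex_of_real \<tau>) * f \<tau> = exp (- z * complex_of_real \<tau>) * F \<tau>"
    using eq by eventually_elim simp
  have "laplace f z = (LINT \<tau>|lborel. exp (- z * complex_of_real \<tau>) * F \<tau>)"
    unfolding laplace_def
    by (rule integral_lebesgue_on_eq_lborel[OF _ _ _ m ae]) (auto simp: causalD[OF F0])
  then show "laplace f z = fourier (weighted (Re z) F) (Im z)"
    unfolding fourier_def laplace_kernel_eq[of z _ F] .
  show "integrable (lebesgue_on {0<..}) (\<lambda>\<tau>. exp (- z * complex_of_real \<tau>) * f \<tau>)
        \<longleftrightarrow> integrable lborel (\<lambda>\<tau>. exp (- z * complex_of_real \<tau>) * F \<tau>)"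
    by (subst integrable_lebesgue_on_iff_lborel[OF _ _ _ m ae]) (auto simp: causalD[OF F0])
qed

lemma laplace_borel:
  assumes F[measurable]: "F \<in> borel_measurable borel" and F0: "causal F"
  shows "laplace F z = fourier (weighted (Re z) F) (Im z)"
  by (rule laplace_eq_fourier[OF F F0]) (auto intro!: measurable_restrict_space1 measurable_completion)

lemma integrable_laplace_kernel:
  assumes [measurable]: "F \<in> borel_measurable borel" and F0: "causal F"
    and fin: "energy (weighted c F) < \<infinity>" and z: "c < Re z"
  shows "integrable lborel (\<lambda>\<tau>. exp (- z * complex_of_real \<tau>) * F \<tau>)"
  unfolding laplace_kernel_eq[of z _ F]
  by (intro integrable_fourier_kernel integrable_weighted[OF assms])

lemma energy_laplace_line:
  assumes [measurable]: "F \<in> borel_measurable borel" and F0: "causal F"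
    and fin: "energy (weighted c F) < \<infinity>" and s: "c < s"
  shows "energy (\<lambda>t. laplace F (Complex s t)) = ennreal (2 * pi) * energy (weighted s F)"
proof -
  have "energy (weighted s F) < \<infinity>"
    using energy_weighted_antimono[OF F0, of c s] fin s by auto
  with plancherel_L1_L2[OF integrable_weighted[OF assms]] show ?thesis
    by (simp add: laplace_borel[OF assms(1) F0] energy_def)
qed

lemma exp_diff_le:
  fixes u v :: complex
  assumes "Re u \<le> m" "Re v \<le> m"
  shows "cmod (exp u - exp v) \<le> exp m * cmod (u - v)"
proof (rule field_differentiable_bound[where S = "{z. Re z \<le> m}" and f = exp and f' = exp])
  show "convex {z. Re z \<le> m}" by (rule convex_halfspace_Re_le)
qed (use assms in \<open>auto intro: DERIV_subset[OF DERIV_exp]\<close>)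

text \<open>
  Differentiation under the integral sign. Within distance \<open>d\<close> of \<open>z\<close> the difference quotients of
  \<open>exp (- z x)\<close> are at most \<open>x exp (- (Re z - d) x)\<close>, and the factor \<open>x\<close> is absorbed by a
  slightly slower exponential.
\<close>

lemma holomorphic_laplace:
  assumes [measurable]: "F \<in> borel_measurable borel" and F0: "causal F"
    and fin: "energy (weighted c F) < \<infinity>"
  shows "laplace F holomorphic_on half_plane c"
  unfolding holomorphic_on_def
proof
  fix z assume "z \<in> half_plane c"
  then have z: "c < Re z" by (simp add: half_plane_def)
  \<comment> \<open>The distance from \<open>Re z\<close> to \<open>c\<close> is split in three: the radius in which \<open>z\<close> varies, the part that absorbs the factor \<open>x\<close>, and a margin that keeps the majorant integrable.\<close>
  define d where "d = (Re z - c) / 3"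
  have d: "d > 0" using z by (simp add: d_def)
  let ?k = "\<lambda>w x. exp (- w * complex_of_real x) * F x"
  have L: "laplace F w = (LINT x|lborel. ?k w x)" for w
    unfolding laplace_borel[OF assms(1) F0] fourier_def laplace_kernel_eq[of w _ F] ..
  have int: "integrable lborel (?k w)" if "c < Re w" for w
    by (rule integrable_laplace_kernel[OF assms that])
  have "(laplace F has_field_derivative (LINT x|lborel. - complex_of_real x * ?k z x)) (at z within ball z d)"
    unfolding has_field_derivative_iff tendsto_at_iff_sequentially
  proof (intro allI impI)
    fix X assume X: "\<forall>i. X i \<in> ball z d - {z}" "X \<longlonglongrightarrow> z"
    have Xd: "Re z - d < Re (X i)" "X i \<noteq> z" for i
    proof -
      have "\<bar>Re (z - X i)\<bar> \<le> cmod (z - X i)" by (rule abs_Re_le_cmod)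
      moreover have "cmod (z - X i) < d" and neq: "X i \<noteq> z"
        using X(1) by (auto simp: dist_norm)
      ultimately show "Re z - d < Re (X i)" by simp
      show "X i \<noteq> z" by (rule neq)
    qed
    have Xc: "c < Re (X i)" for i
      using Xd(1)[of i] d unfolding d_def by (simp add: field_simps)
    have eq: "(laplace F (X i) - laplace F z) / (X i - z) = (LINT x|lborel. (?k (X i) x - ?k z x) / (X i - z))" for i
      unfolding L using int[OF Xc[of i]] int[OF z] by simp
    have "(\<lambda>i. LINT x|lborel. (?k (X i) x - ?k z x) / (X i - z)) \<longlonglongrightarrow> (LINT x|lborel. - complex_of_real x * ?k z x)"
    proof (rule integral_dominated_convergence)
      show "integrable lborel (\<lambda>x. 1 / d * cmod (weighted (c + d) F x))"
        using integrable_weighted[OF assms, where s = "c + d"] d by simp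
      show "AE x in lborel. (\<lambda>i. (?k (X i) x - ?k z x) / (X i - z)) \<longlonglongrightarrow> - complex_of_real x * ?k z x"
      proof (rule AE_I2)
        fix x
        have "((\<lambda>w. ?k w x) has_field_derivative - complex_of_real x * ?k z x) (at z)"
          by (auto intro!: derivative_eq_intros)
        then have "((\<lambda>w. (?k w x - ?k z x) / (w - z)) \<longlongrightarrow> - complex_of_real x * ?k z x) (at z)"
          by (simp add: has_field_derivative_iff)
        then have "(((\<lambda>w. (?k w x - ?k z x) / (w - z)) \<circ> X) \<longlongrightarrow> - complex_of_real x * ?k z x) sequentially"
          using X unfolding tendsto_at_iff_sequentially by auto
        then show "(\<lambda>i. (?k (X i) x - ?k z x) / (X i - z)) \<longlonglongrightarrow> - complex_of_real x * ?k z x"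
          by (simp add: comp_def)
      qed
      show "AE x in lborel. cmod ((?k (X i) x - ?k z x) / (X i - z)) \<le> 1 / d * cmod (weighted (c + d) F x)" for i
      proof (rule AE_I2)
        fix x
        show "cmod ((?k (X i) x - ?k z x) / (X i - z)) \<le> 1 / d * cmod (weighted (c + d) F x)"
        proof (cases "x \<le> 0")
          case True
          then show ?thesis using causalD[OF F0, of x] d by simp
        next
          case False
          then have x: "x > 0" by simp
          have b: "Re (- w * complex_of_real x) \<le> - (Re z - d) * x" if "Re z - d \<le> Re w" for w
            using mult_right_mono[of "Re z - d" "Re w" x] that x by (simp add: algebra_simps)
          have "cmod (exp (- X i * x) - exp (- z * x)) \<le> exp (- (Re z - d) * x) * cmod (- X i * x - (- z * x))"
            using Xd(1)[of i] d by (intro exp_diff_le b) auto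
          also have "cmod (- X i * x - (- z * x)) = x * cmod (X i - z)"
          proof -
            have "- X i * x - (- z * x) = - (x * (X i - z))" by (simp add: algebra_simps)
            then show ?thesis using x by (simp add: norm_mult)
          qed
          finally have 1: "cmod (exp (- X i * x) - exp (- z * x)) / cmod (X i - z) \<le> exp (- (Re z - d) * x) * x"
            using Xd(2)[of i] by (simp add: divide_le_eq mult.assoc)
          have "d * x \<le> exp (d * x)"
            using exp_ge_add_one_self[of "d * x"] by linarith
          then have "x \<le> exp (d * x) / d"
            using d by (simp add: field_simps)
          then have "exp (- (Re z - d) * x) * x \<le> exp (- (Re z - d) * x) * (exp (d * x) / d)"
            by (intro mult_left_mono) auto
          also have "\<dots> = 1 / d * exp (- (c + d) * x)"
            by (simp add: d_def field_simps flip: exp_add)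
          finally have 2: "cmod (exp (- X i * x) - exp (- z * x)) / cmod (X i - z) \<le> 1 / d * exp (- (c + d) * x)"
            using 1 by linarith
          have "cmod ((?k (X i) x - ?k z x) / (X i - z))
             = cmod (exp (- X i * x) - exp (- z * x)) / cmod (X i - z) * cmod (F x)"
            by (simp add: norm_divide norm_mult flip: left_diff_distrib)
          also have "\<dots> \<le> 1 / d * exp (- (c + d) * x) * cmod (F x)"
            by (intro mult_right_mono 2) auto
          finally show ?thesis by (simp add: weighted_def norm_mult)
        qed
      qed
    qed measurable
    then show "((\<lambda>w. (laplace F w - laplace F z) / (w - z)) \<circ> X) \<longlonglongrightarrow> (LINT x|lborel. - complex_of_real x * ?k z x)"
      by (simp add: comp_def eq)
  qed
  then have "laplace F field_differentiable at z"
    using d by (auto simp: field_differentiable_def at_within_open[of z "ball z d"])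
  then show "laplace F field_differentiable at z within half_plane c"
    by (rule field_differentiable_at_within)
qed

section \<open>The Paley-Wiener theorem\<close>

lemma L2_pairing_tendsto:
  fixes u :: "nat \<Rightarrow> real \<Rightarrow> complex"
  assumes [measurable]: "\<And>n. u n \<in> borel_measurable borel" "U \<in> borel_measurable borel" "v \<in> borel_measurable borel"
    and fin: "\<And>n. energy (u n) < \<infinity>" "energy U < \<infinity>" "energy v < \<infinity>"
    and lim: "(\<lambda>n. energy (\<lambda>x. U x - u n x)) \<longlonglongrightarrow> 0"
  shows "(\<lambda>n. LINT x|lborel. u n x * v x) \<longlonglongrightarrow> (LINT x|lborel. U x * v x)"
proof -
  let ?D = "\<lambda>n. (LINT x|lborel. U x * v x) - (LINT x|lborel. u n x * v x)"
  have le: "ennreal ((cmod (?D n))\<^sup>2) \<le> energy v * energy (\<lambda>x. U x - u n x)" for n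
  proof -
    have "?D n = (LINT x|lborel. (U x - u n x) * v x)"
      by (subst Bochner_Integration.integral_diff[symmetric])
         (auto intro!: integrable_mult_energy fin Bochner_Integration.integral_cong simp: left_diff_distrib)
    then show ?thesis
      using cmod_integral_mult_le[of "\<lambda>x. U x - u n x" v] energy_diff_finite[of U "u n"] fin
      by (simp add: mult.commute)
  qed
  have "(\<lambda>n. energy v * energy (\<lambda>x. U x - u n x)) \<longlonglongrightarrow> energy v * 0"
    using fin by (intro ennreal_tendsto_cmult lim) auto
  then have "(\<lambda>n. energy v * energy (\<lambda>x. U x - u n x)) \<longlonglongrightarrow> 0" by simp
  then have "(\<lambda>n. ennreal ((cmod (?D n))\<^sup>2)) \<longlonglongrightarrow> 0"
    by (rule tendsto_sandwich[OF _ _ tendsto_const, rotated -1]) (auto simp: le)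
  then have "(\<lambda>n. ennreal ((cmod (?D n))\<^sup>2)) \<longlonglongrightarrow> ennreal 0" by simp
  then have "(\<lambda>n. (cmod (?D n))\<^sup>2) \<longlonglongrightarrow> 0"
    by (subst (asm) tendsto_ennreal_iff) auto
  then have "(\<lambda>n. sqrt ((cmod (?D n))\<^sup>2)) \<longlonglongrightarrow> sqrt 0" by (intro tendsto_intros)
  then have "(\<lambda>n. cmod (?D n)) \<longlonglongrightarrow> 0" by simp
  then have "?D \<longlonglongrightarrow> 0" by (rule tendsto_norm_zero_cancel)
  then have "(\<lambda>n. (LINT x|lborel. U x * v x) - ?D n) \<longlonglongrightarrow> (LINT x|lborel. U x * v x) - 0"
    by (intro tendsto_intros)
  then show ?thesis by simp
qed

lemma energy_reflect:
  assumes [measurable]: "g \<in> borel_measurable borel"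
  shows "energy (\<lambda>x. g (- x)) = energy g"
  unfolding energy_def using nn_integral_real_affine[of "\<lambda>x. ennreal ((cmod (g x))\<^sup>2)" "-1" 0] by simp

lemma energy_cmult: 
  assumes [measurable]: "g \<in> borel_measurable borel"
  shows "energy (\<lambda>x. a * g x) = ennreal ((cmod a)\<^sup>2) * energy g"
  unfolding energy_def
  by (subst nn_integral_cmult[symmetric]) (auto simp: norm_mult power_mult_distrib ennreal_mult)

lemma fourier_exp_halfline_reflected:
  assumes "Re w > 0"
  shows "fourier (\<lambda>x. exp_halfline w (- x)) t = 1 / (w - \<i> * complex_of_real t)"
proof -
  have "fourier (\<lambda>x. exp_halfline w (- x)) t = (LINT x|lborel. exp (\<i> * complex_of_real t * complex_of_real x) * exp_halfline w x)"
    unfolding fourier_def by (subst lborel_integral_real_affine[where c = "-1" and t = 0]) auto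
  also have "\<dots> = (LINT x|lborel. exp_halfline (w - \<i> * complex_of_real t) x)"
    by (intro Bochner_Integration.integral_cong refl)
       (simp add: exp_halfline_def indicator_def algebra_simps flip: exp_add)
  also have "\<dots> = 1 / (w - \<i> * complex_of_real t)"
    using assms by (intro integral_exp_halfline) simp
  finally show ?thesis .
qed

text \<open>
  Up to the factor \<open>exp (s x) / (2 \<pi>)\<close>, the function \<open>F\<close> is the reflection of the Plancherel
  transform \<open>g\<close> of the restriction \<open>G\<close> of \<open>h\<close> to the line \<open>Re z = s\<close>, cut off to the right
  half-line. With \<open>k\<close> the reflected exponential, \<open>2\<pi> LF(z)\<close> is the pairing of \<open>g\<close> with \<open>k\<close>. By the multiplication
  formula for the truncations and a limit in \<open>L\<^sup>2\<close>, it equals the pairing of \<open>G\<close> with \<open>fourier k\<close>,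
  which is a Cauchy kernel.
\<close>

lemma Hardy_inverse_above:
  assumes hol: "h holomorphic_on half_plane c" and M: "M \<ge> 0" "\<And>s. c < s \<Longrightarrow> energy (\<lambda>t. h (Complex s t)) \<le> ennreal M"
    and s: "c < s"
  shows "\<exists>F \<in> borel_measurable borel. causal F \<and> energy (weighted s F) \<le> ennreal (M / (2 * pi))
           \<and> (\<forall>z\<in>half_plane s. laplace F z = h z)"
proof -
  have cont: "continuous_on (half_plane c) h"
    using hol by (rule holomorphic_on_imp_continuous_on)
  define G where "G t = h (Complex s t)" for t
  have [measurable]: "G \<in> borel_measurable borel"
    unfolding G_def by (rule borel_measurable_line[OF cont s])
  have EG: "energy G \<le> ennreal M" using M(2)[OF s] by (simp add: G_def[abs_def])
  then have finG: "energy G < \<infinity>" by (auto intro: le_less_trans)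
  obtain g where [measurable]: "g \<in> borel_measurable borel"
    and lim: "((\<lambda>R. energy (\<lambda>t. g t - fourier (cutoff R G) t)) \<longlongrightarrow> 0) at_top"
    using plancherel_L2_exists[of G] finG by auto
  have eg: "energy g = ennreal (2 * pi) * energy G"
    using finG lim by (intro plancherel_L2_isometry) auto
  have fing: "energy g < \<infinity>" using finG by (simp add: eg ennreal_mult_less_top)
  define F where "F x = indicator {0<..} x * (complex_of_real (exp (s * x)) * g (- x) / (2 * pi))" for x
  have [measurable]: "F \<in> borel_measurable borel" unfolding F_def by measurable
  have F0: "causal F" by (simp add: causal_def F_def)
  have wF: "weighted s F x = indicator {0<..} x * (g (- x) / (2 * pi))" for x
    by (simp add: weighted_def F_def exp_minus field_simps)
  have "energy (weighted s F) \<le> energy (\<lambda>x. (1 / (2 * pi)) * g (- x))"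
    by (intro energy_mono) (auto simp: wF indicator_def norm_divide norm_mult)
  also have "\<dots> = ennreal ((cmod (1 / (2 * pi)))\<^sup>2) * energy g"
    by (subst energy_cmult) (auto simp: energy_reflect)
  also have "\<dots> \<le> ennreal ((1 / (2 * pi))\<^sup>2) * (ennreal (2 * pi) * ennreal M)"
    unfolding eg using EG by (intro mult_mono) (auto simp: norm_divide norm_mult intro: mult_left_mono)
  also have "\<dots> = ennreal (M / (2 * pi))"
    using M(1) by (simp add: power2_eq_square field_simps flip: ennreal_mult)
  finally have EF: "energy (weighted s F) \<le> ennreal (M / (2 * pi))" .
  have "laplace F z = h z" if "z \<in> half_plane s" for z
  proof -
    define w where "w = z - complex_of_real s"
    have w: "Re w > 0" using that by (simp add: w_def half_plane_def)
    define k where "k x = exp_halfline w (- x)" for x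
    have [measurable]: "k \<in> borel_measurable borel" unfolding k_def by measurable
    have finK: "energy k < \<infinity>"
      using energy_exp_halfline[OF w] unfolding k_def by (subst energy_reflect) auto
    have intk: "integrable lborel k"
      using lborel_integrable_real_affine[OF integrable_exp_halfline[OF w], of "-1" 0] by (simp add: k_def[abs_def])
    have fk: "fourier k t = 1 / (z - Complex s t)" for t
      using fourier_exp_halfline_reflected[OF w, of t]
      by (simp add: k_def[abs_def] w_def Complex_eq diff_diff_eq)
    have zs: "s \<noteq> Re z" using that by (auto simp: half_plane_def)
    have finfk: "energy (fourier k) < \<infinity>"
    proof -
      have "energy (fourier k) = energy (\<lambda>t. 1 / (Complex s t - z))"
        unfolding energy_def fk by (simp add: norm_divide norm_minus_commute)
      then show ?thesis by (simp add: energy_Cauchy_kernel[OF zs])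
    qed
    have fincut: "energy (cutoff R G) < \<infinity>" for R
    proof -
      have "energy (cutoff R G) \<le> energy G"
        by (intro energy_mono) (auto simp: cutoff_def indicator_def)
      then show ?thesis using finG by auto
    qed
    have intcut: "integrable lborel (cutoff R G)" for R
      using finG by (intro integrable_cutoff) auto
    have "(\<lambda>n. LINT t|lborel. fourier (cutoff (real n) G) t * k t) \<longlonglongrightarrow> (LINT t|lborel. g t * k t)"
    proof (rule L2_pairing_tendsto)
      show "energy (fourier (cutoff (real n) G)) < \<infinity>" for n
        unfolding plancherel_L1_L2[OF intcut fincut] using fincut[of "real n"] by (simp add: ennreal_mult_less_top)
      show "(\<lambda>n. energy (\<lambda>x. g x - fourier (cutoff (real n) G) x)) \<longlonglongrightarrow> 0"
        by (rule filterlim_compose[OF lim filterlim_real_sequentially])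
    qed (use fing finK in auto)
    moreover have "(\<lambda>n. LINT t|lborel. cutoff (real n) G t * fourier k t) \<longlonglongrightarrow> (LINT t|lborel. G t * fourier k t)"
    proof (rule L2_pairing_tendsto)
      show "(\<lambda>n. energy (\<lambda>x. G x - cutoff (real n) G x)) \<longlonglongrightarrow> 0"
        using finG by (intro filterlim_compose[OF energy_tail_tendsto filterlim_real_sequentially]) auto
    qed (use fincut finG finfk in auto)
    ultimately have "(LINT t|lborel. g t * k t) = (LINT t|lborel. G t * fourier k t)"
      unfolding fourier_multiplication_formula[OF intcut intk] by (rule LIMSEQ_unique)
    also have "\<dots> = 2 * pi * h z"
      unfolding fk G_def using that by (intro half_plane_Cauchy_formula[OF hol M s, symmetric]) (auto simp: half_plane_def)
    finally have gk: "(LINT t|lborel. g t * k t) = 2 * pi * h z" .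
    have "laplace F z = (LINT x|lborel. (1 / (2 * pi)) * (g (- x) * k (- x)))"
      unfolding laplace_borel[OF \<open>F \<in> borel_measurable borel\<close> F0] fourier_def
    proof (intro Bochner_Integration.integral_cong refl)
      fix x
      have "exp (- \<i> * complex_of_real (Im z) * complex_of_real x) * weighted (Re z) F x = exp (- z * complex_of_real x) * F x"
        by (rule laplace_kernel_eq[symmetric])
      also have "\<dots> = exp (- w * complex_of_real x) * (indicator {0<..} x * (g (- x) / (2 * pi)))"
      proof -
        have "exp (- w * complex_of_real x) = exp (- z * complex_of_real x + complex_of_real (s * x))"
          by (simp add: w_def algebra_simps)
        then have "exp (- w * complex_of_real x) = exp (- z * complex_of_real x) * complex_of_real (exp (s * x))"
          by (simp only: exp_add exp_of_real)
        then show ?thesis by (simp add: F_def)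
      qed
      also have "\<dots> = (1 / (2 * pi)) * (g (- x) * k (- x))"
        by (simp add: k_def exp_halfline_def)
      finally show "exp (- \<i> * complex_of_real (Im z) * complex_of_real x) * weighted (Re z) F x = (1 / (2 * pi)) * (g (- x) * k (- x))" .
    qed
    also have "\<dots> = (1 / (2 * pi)) * (LINT x|lborel. g (- x) * k (- x))"
      by (rule integral_mult_right_zero)
    also have "(LINT x|lborel. g (- x) * k (- x)) = (LINT t|lborel. g t * k t)"
      by (subst (2) lborel_integral_real_affine[where c = "-1" and t = 0]) auto
    finally show ?thesis unfolding gk by simp
  qed
  with F0 EF show ?thesis by (intro bexI[of _ F]) auto
qed

text \<open>
  Equality of the transforms on a single line \<open>Re z = s > c\<close> already makes the
  difference of the weighted functions have transform \<open>0\<close>, hence norm \<open>0\<close>.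
\<close>

lemma laplace_injective:
  assumes [measurable]: "F \<in> borel_measurable borel" "G \<in> borel_measurable borel" and c0: "causal F" "causal G"
    and fin: "energy (weighted c F) < \<infinity>" "energy (weighted c G) < \<infinity>"
    and eq: "\<And>z. z \<in> half_plane c \<Longrightarrow> laplace F z = laplace G z"
  shows "AE x in lborel. F x = G x"
proof -
  define s where "s = c + 1"
  have s: "c < s" by (simp add: s_def)
  have int: "integrable lborel (weighted s F)" "integrable lborel (weighted s G)"
    using integrable_weighted[OF _ c0(1) fin(1) s] integrable_weighted[OF _ c0(2) fin(2) s] by auto
  define D where "D x = weighted s F x - weighted s G x" for x
  have [measurable]: "D \<in> borel_measurable borel" unfolding D_def by measurable
  have finD: "energy D < \<infinity>"
    unfolding D_def
    using energy_weighted_antimono[OF c0(1) less_imp_le[OF s]] energy_weighted_antimono[OF c0(2) less_imp_le[OF s]] fin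
    by (intro energy_diff_finite) auto
  have "fourier D t = 0" for t
  proof -
    have "laplace F (Complex s t) = laplace G (Complex s t)"
      using s by (intro eq) (simp add: half_plane_def)
    then have "fourier (weighted s F) t = fourier (weighted s G) t"
      using c0 by (simp add: laplace_borel)
    then show ?thesis unfolding D_def fourier_diff[OF int] by simp
  qed
  then have "energy (fourier D) = 0" by (simp add: energy_def)
  moreover have "integrable lborel D" unfolding D_def using int by auto
  ultimately have "energy D = 0"
    using plancherel_L1_L2[of D] finD by simp
  then have "AE x in lborel. ennreal ((cmod (D x))\<^sup>2) = 0"
    unfolding energy_def by (subst (asm) nn_integral_0_iff_AE) auto
  then show ?thesis
    by eventually_elim (simp add: D_def weighted_def flip: right_diff_distrib)
qed

lemma energy_cong_AE:
  assumes "AE x in lborel. F x = G x"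
  shows "energy F = energy G"
  unfolding energy_def using assms by (intro nn_integral_cong_AE) auto

text \<open>
  The inverse transforms from different lines agree almost everywhere by injectivity, so one of
  them serves for all lines. The reference line is \<open>Re z = c + 1\<close>.
\<close>

theorem Paley_Wiener:
  assumes hol: "h holomorphic_on half_plane c" and M: "M \<ge> 0" "\<And>s. c < s \<Longrightarrow> energy (\<lambda>t. h (Complex s t)) \<le> ennreal M"
  shows "\<exists>F \<in> borel_measurable borel. causal F \<and> energy (weighted c F) < \<infinity>
           \<and> (\<forall>z\<in>half_plane c. laplace F z = h z)"
proof -
  have "c < c + 1" by simp
  from Hardy_inverse_above[OF hol M this] obtain F where [measurable]: "F \<in> borel_measurable borel"
    and F: "causal F" "energy (weighted (c + 1) F) \<le> ennreal (M / (2 * pi))" "\<And>z. z \<in> half_plane (c + 1) \<Longrightarrow> laplace F z = h z"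
    by auto
  have below: "energy (weighted s F) \<le> ennreal (M / (2 * pi)) \<and> (\<forall>z\<in>half_plane s. laplace F z = h z)"
    if s: "c < s" "s \<le> c + 1" for s
  proof -
    obtain G where [measurable]: "G \<in> borel_measurable borel"
      and G: "causal G" "energy (weighted s G) \<le> ennreal (M / (2 * pi))" "\<And>z. z \<in> half_plane s \<Longrightarrow> laplace G z = h z"
      using Hardy_inverse_above[OF hol M s(1)] by auto
    have "AE x in lborel. F x = G x"
    proof (rule laplace_injective[where c = "c + 1"])
      show "energy (weighted (c + 1) F) < \<infinity>" using F(2) by (auto intro: le_less_trans)
      show "energy (weighted (c + 1) G) < \<infinity>"
        using order_trans[OF energy_weighted_antimono[OF G(1) s(2)] G(2)] by (auto intro: le_less_trans)
      fix z assume "z \<in> half_plane (c + 1)"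
      then show "laplace F z = laplace G z"
        using F(3) G(3) s by (auto simp: half_plane_def)
    qed (use F G in auto)
    then have ae: "AE x in lborel. weighted r F x = weighted r G x" for r
      by (auto simp: weighted_def)
    have "laplace F z = laplace G z" for z
      unfolding laplace_borel[OF \<open>F \<in> _\<close> F(1)] laplace_borel[OF \<open>G \<in> _\<close> G(1)] fourier_def
      by (intro integral_cong_AE) (use ae[of "Re z"] in auto)
    with G ae[of s, THEN energy_cong_AE] show ?thesis by auto
  qed
  have "energy (weighted c F) \<le> ennreal (M / (2 * pi))"
  proof (rule energy_weighted_le)
    fix s assume s: "c < s"
    show "energy (weighted s F) \<le> ennreal (M / (2 * pi))"
    proof (cases "s \<le> c + 1")
      case False
      then have "energy (weighted s F) \<le> energy (weighted (c + 1) F)"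
        by (intro energy_weighted_antimono F) auto
      with F(2) show ?thesis by simp
    qed (use below s in auto)
  qed (auto intro: F)
  then have "energy (weighted c F) < \<infinity>" by (auto intro: le_less_trans)
  moreover have "laplace F z = h z" if "z \<in> half_plane c" for z
  proof -
    define s where "s = min (c + 1) ((c + Re z) / 2)"
    have "c < s" "s \<le> c + 1" "z \<in> half_plane s"
      using that by (auto simp: s_def half_plane_def min_def field_simps)
    with below show ?thesis by auto
  qed
  ultimately show ?thesis using F(1) by (intro bexI[of _ F]) auto
qed

section \<open>The Laplace transform on the weighted space\<close>

definition represents :: "(real \<Rightarrow> complex) \<Rightarrow> (real \<Rightarrow> complex) \<Rightarrow> bool" where
  "represents F f \<longleftrightarrow> F \<in> borel_measurable borel \<and> causal F
     \<and> f \<in> borel_measurable (lebesgue_on {0<..}) \<and> (AE x in lebesgue_on {0<..}. f x = F x)"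

lemma represents_self: "F \<in> borel_measurable borel \<Longrightarrow> causal F \<Longrightarrow> represents F F"
  by (auto simp: represents_def intro!: measurable_restrict_space1 measurable_completion)

lemma laplace_represents:
  assumes "represents F f"
  shows "laplace f = laplace F"
  using assms laplace_eq_fourier[of F f] laplace_borel[of F] by (auto simp: represents_def)

lemma borel_measurable_continuous_lebesgue_on:
  fixes k :: "real \<Rightarrow> complex"
  assumes "continuous_on UNIV k"
  shows "k \<in> borel_measurable (lebesgue_on A)"
  by (intro measurable_restrict_space1 measurable_completion) (use assms borel_measurable_continuous_onI in auto)

lemma L2_sqnorm_weighted:
  assumes "represents F f"
  shows "L2_sqnorm {0<..} (weighted s f) = energy (weighted s F)"
proof (rule L2_sqnorm_eq_energy)
  show "AE x in lebesgue_on {0<..}. weighted s f x = weighted s F x"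
    using assms unfolding represents_def weighted_def by (auto elim: eventually_mono)
qed (use assms in \<open>auto simp: represents_def weighted_def causal_def\<close>)

lemma member_iff_representative:
  "f \<in> members (L2_weighted c) \<longleftrightarrow> (\<exists>F. represents F f \<and> energy (weighted c F) < \<infinity>)"
proof
  assume f: "f \<in> members (L2_weighted c)"
  then have m: "weighted c f \<in> borel_measurable (lebesgue_on {0<..})" and fin: "L2_sqnorm {0<..} (weighted c f) < \<infinity>"
    by (auto simp: L2_weighted_def L2_def)
  have "(\<lambda>x. complex_of_real (exp (c * x))) \<in> borel_measurable (lebesgue_on {0<..})"
    by (intro borel_measurable_continuous_lebesgue_on continuous_intros)
  then have "(\<lambda>x. complex_of_real (exp (c * x)) * weighted c f x) \<in> borel_measurable (lebesgue_on {0<..})"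
    by (intro borel_measurable_times m)
  also have "(\<lambda>x. complex_of_real (exp (c * x)) * weighted c f x) = f"
    by (auto simp: weighted_def exp_minus)
  finally have fm: "f \<in> borel_measurable (lebesgue_on {0<..})" .
  obtain F where "F \<in> borel_measurable borel" "\<forall>x. x \<notin> {0<..} \<longrightarrow> F x = 0" "AE x in lebesgue_on {0<..}. f x = F x"
    using borel_representative[OF _ fm] by auto
  then have "represents F f" using fm by (auto simp: represents_def causal_def)
  with fin L2_sqnorm_weighted[OF this, of c] show "\<exists>F. represents F f \<and> energy (weighted c F) < \<infinity>"
    by auto
next
  assume "\<exists>F. represents F f \<and> energy (weighted c F) < \<infinity>"
  then obtain F where F: "represents F f" "energy (weighted c F) < \<infinity>" by auto
  have "(\<lambda>x. complex_of_real (exp (- c * x))) \<in> borel_measurable (lebesgue_on {0<..})"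
    by (intro borel_measurable_continuous_lebesgue_on continuous_intros)
  then have "weighted c f \<in> borel_measurable (lebesgue_on {0<..})"
    unfolding weighted_def[abs_def] using F by (intro borel_measurable_times) (auto simp: represents_def)
  with F L2_sqnorm_weighted[OF F(1), of c] show "f \<in> members (L2_weighted c)"
    by (auto simp: L2_weighted_def L2_def)
qed

lemma representative:
  assumes "f \<in> members (L2_weighted c)"
  obtains F where "F \<in> borel_measurable borel" "causal F" "energy (weighted c F) < \<infinity>" "represents F f"
  using assms unfolding member_iff_representative by (auto simp: represents_def)

lemma laplace_integrable:
  assumes f: "f \<in> members (L2_weighted c)" and z: "z \<in> half_plane c"
  shows "integrable (lebesgue_on {0<..}) (\<lambda>\<tau>. exp (- z * complex_of_real \<tau>) * f \<tau>)"
proof -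
  obtain F where F: "F \<in> borel_measurable borel" "causal F" "energy (weighted c F) < \<infinity>" "represents F f"
    using f by (rule representative)
  then show ?thesis
    using z integrable_laplace_kernel[OF F(1-3), of z] laplace_integrable_iff[of F f z]
    by (auto simp: represents_def half_plane_def)
qed

lemma laplace_add:
  assumes "f \<in> members (L2_weighted c)" "g \<in> members (L2_weighted c)" "z \<in> half_plane c"
  shows "laplace (\<lambda>x. f x + g x) z = laplace f z + laplace g z"
  unfolding laplace_def using laplace_integrable[OF assms(1,3)] laplace_integrable[OF assms(2,3)]
  by (simp add: distrib_left)

lemma laplace_cmult:
  shows "laplace (\<lambda>x. a * f x) z = a * laplace f z"
proof -
  have "(\<lambda>\<tau>. exp (- z * complex_of_real \<tau>) * (a * f \<tau>)) = (\<lambda>\<tau>. a * (exp (- z * complex_of_real \<tau>) * f \<tau>))"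
    by (auto simp: mult_ac)
  then show ?thesis unfolding laplace_def by (simp only: integral_mult_right_zero)
qed

lemma members_add:
  assumes "f \<in> members (L2_weighted c)" "g \<in> members (L2_weighted c)"
  shows "(\<lambda>x. f x + g x) \<in> members (L2_weighted c)"
proof -
  obtain F where F: "F \<in> borel_measurable borel" "causal F" "energy (weighted c F) < \<infinity>" "represents F f"
    using assms(1) by (rule representative)
  obtain G where G: "G \<in> borel_measurable borel" "causal G" "energy (weighted c G) < \<infinity>" "represents G g"
    using assms(2) by (rule representative)
  have "represents (\<lambda>x. F x + G x) (\<lambda>x. f x + g x)"
    using F(4) G(4) unfolding represents_def by (auto simp: causal_def)
  moreover have "energy (weighted c (\<lambda>x. F x + G x)) < \<infinity>"
  proof -
    have "weighted c (\<lambda>x. F x + G x) = (\<lambda>x. weighted c F x + weighted c G x)"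
      by (auto simp: weighted_def algebra_simps)
    then have "energy (weighted c (\<lambda>x. F x + G x))
        \<le> ennreal (1 + 1) * energy (weighted c F) + ennreal (1 + 1 / 1) * energy (weighted c G)"
      using F(1) G(1) energy_add_le[of "weighted c F" "weighted c G" 1] by auto
    also have "\<dots> < \<infinity>" using F(3) G(3) by (auto simp: ennreal_mult_less_top)
    finally show ?thesis .
  qed
  ultimately show ?thesis unfolding member_iff_representative by blast
qed

lemma members_cmult:
  assumes "f \<in> members (L2_weighted c)"
  shows "(\<lambda>x. a * f x) \<in> members (L2_weighted c)"
proof -
  obtain F where F: "F \<in> borel_measurable borel" "causal F" "energy (weighted c F) < \<infinity>" "represents F f"
    using assms by (rule representative)
  have "represents (\<lambda>x. a * F x) (\<lambda>x. a * f x)"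
    using F(4) unfolding represents_def by (auto simp: causal_def)
  moreover have "weighted c (\<lambda>x. a * F x) = (\<lambda>x. a * weighted c F x)"
    by (auto simp: weighted_def)
  then have "energy (weighted c (\<lambda>x. a * F x)) < \<infinity>"
    using F(1,3) by (simp add: energy_cmult ennreal_mult_less_top)
  ultimately show ?thesis unfolding member_iff_representative by blast
qed

lemma Hardy_sqnorm_laplace:
  assumes "F \<in> borel_measurable borel" "causal F" "energy (weighted c F) < \<infinity>"
  shows "Hardy_sqnorm c (laplace F) = ennreal (2 * pi) * energy (weighted c F)"
proof -
  have line: "L2_sqnorm UNIV (\<lambda>t. laplace F (Complex s t)) = ennreal (2 * pi) * energy (weighted s F)" if s: "c < s" for s
  proof -
    have "(\<lambda>t. laplace F (Complex s t)) \<in> borel_measurable borel"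
      using assms(1) by (simp add: laplace_borel[OF assms(1,2)])
    then show ?thesis
      using energy_laplace_line[OF assms s] by (simp add: L2_sqnorm_UNIV)
  qed
  show ?thesis
  proof (rule antisym)
    show "Hardy_sqnorm c (laplace F) \<le> ennreal (2 * pi) * energy (weighted c F)"
      unfolding Hardy_sqnorm_def
      by (intro SUP_least) (auto simp: line intro!: mult_left_mono energy_weighted_antimono assms)
    let ?S = "Hardy_sqnorm c (laplace F)"
    have cancel: "ennreal (1 / (2 * pi)) * (ennreal (2 * pi) * x) = x" for x
      by (simp add: mult.assoc[symmetric] ennreal_mult[symmetric])
    have "energy (weighted c F) \<le> ennreal (1 / (2 * pi)) * ?S"
    proof (rule energy_weighted_le[OF assms(1,2)])
      fix s assume s: "c < s"
      then have "ennreal (2 * pi) * energy (weighted s F) \<le> ?S"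
        unfolding Hardy_sqnorm_def line[OF s, symmetric] by (intro SUP_upper) auto
      then have "ennreal (1 / (2 * pi)) * (ennreal (2 * pi) * energy (weighted s F)) \<le> ennreal (1 / (2 * pi)) * ?S"
        by (rule mult_left_mono) simp
      then show "energy (weighted s F) \<le> ennreal (1 / (2 * pi)) * ?S" unfolding cancel .
    qed
    then have "ennreal (2 * pi) * energy (weighted c F) \<le> ennreal (2 * pi) * (ennreal (1 / (2 * pi)) * ?S)"
      by (rule mult_left_mono) simp
    also have "\<dots> = ?S" by (simp add: mult.assoc[symmetric] ennreal_mult[symmetric])
    finally show "ennreal (2 * pi) * energy (weighted c F) \<le> ?S" .
  qed
qed

lemma fnorm_laplace:
  assumes "f \<in> members (L2_weighted c)"
  shows "fnorm (Hardy2 c) (laplace f) = sqrt (2 * pi) * fnorm (L2_weighted c) f"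
proof -
  obtain F where F: "F \<in> borel_measurable borel" "causal F" "energy (weighted c F) < \<infinity>" "represents F f"
    using assms by (rule representative)
  show ?thesis
    by (simp add: Hardy2_def L2_weighted_def L2_norm_def laplace_represents[OF F(4)] Hardy_sqnorm_laplace[OF F(1-3)]
        L2_sqnorm_weighted[OF F(4)] enn2real_mult real_sqrt_mult)
qed

lemma laplace_member:
  assumes "f \<in> members (L2_weighted c)"
  shows "laplace f \<in> members (Hardy2 c)"
proof -
  obtain F where F: "F \<in> borel_measurable borel" "causal F" "energy (weighted c F) < \<infinity>" "represents F f"
    using assms by (rule representative)
  then show ?thesis
    by (simp add: Hardy2_def laplace_represents[OF F(4)] Hardy_sqnorm_laplace[OF F(1-3)] holomorphic_laplace ennreal_mult_less_top)
qed

lemma laplace_cong: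
  assumes "f \<in> members (L2_weighted c)" "g \<in> members (L2_weighted c)" "same (L2_weighted c) f g"
  shows "laplace f = laplace g"
proof -
  obtain F where F: "represents F f" using assms(1) by (rule representative)
  obtain G where G: "represents G g" using assms(2) by (rule representative)
  have "AE x in lebesgue_on {0<..}. f x = g x" using assms(3) by (simp add: L2_weighted_def)
  then have "AE x in lebesgue_on {0<..}. f x = G x"
    using G unfolding represents_def by (auto elim: eventually_elim2)
  then have "represents G f" using F G by (auto simp: represents_def)
  then show ?thesis using laplace_represents G by metis
qed

lemma laplace_injective_on_members:
  assumes "f \<in> members (L2_weighted c)" "g \<in> members (L2_weighted c)"
    and eq: "\<And>z. z \<in> half_plane c \<Longrightarrow> laplace f z = laplace g z"
  shows "same (L2_weighted c) f g"
proof -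
  obtain F where F: "F \<in> borel_measurable borel" "causal F" "energy (weighted c F) < \<infinity>" "represents F f"
    using assms(1) by (rule representative)
  obtain G where G: "G \<in> borel_measurable borel" "causal G" "energy (weighted c G) < \<infinity>" "represents G g"
    using assms(2) by (rule representative)
  have "AE x in lborel. F x = G x"
    using eq by (intro laplace_injective[OF F(1) G(1) F(2) G(2) F(3) G(3)])
      (simp add: laplace_represents[OF F(4)] laplace_represents[OF G(4)])
  then have "AE x in lebesgue_on {0<..}. F x = G x"
    by (subst AE_restrict_space_iff) (auto intro: AE_completion)
  moreover have "AE x in lebesgue_on {0<..}. f x = F x" "AE x in lebesgue_on {0<..}. g x = G x"
    using F(4) G(4) by (auto simp: represents_def)
  ultimately have "AE x in lebesgue_on {0<..}. f x = g x" by eventually_elim simp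
  then show ?thesis by (simp add: L2_weighted_def)
qed

lemma laplace_surjective_on_members:
  assumes h: "h \<in> members (Hardy2 c)"
  shows "\<exists>f\<in>members (L2_weighted c). \<forall>z\<in>half_plane c. laplace f z = h z"
proof -
  have hol: "h holomorphic_on half_plane c" and fin: "Hardy_sqnorm c h < \<infinity>"
    using h by (auto simp: Hardy2_def)
  define M where "M = enn2real (Hardy_sqnorm c h)"
  have M: "Hardy_sqnorm c h = ennreal M" "M \<ge> 0" using fin by (auto simp: M_def)
  have "energy (\<lambda>t. h (Complex s t)) \<le> ennreal M" if s: "c < s" for s
  proof -
    have "(\<lambda>t. h (Complex s t)) \<in> borel_measurable borel"
      using hol s by (intro borel_measurable_line holomorphic_on_imp_continuous_on)
    then have "energy (\<lambda>t. h (Complex s t)) = L2_sqnorm UNIV (\<lambda>t. h (Complex s t))"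
      by (simp add: L2_sqnorm_UNIV)
    also have "\<dots> \<le> ennreal M"
      unfolding M(1)[symmetric] Hardy_sqnorm_def using s by (intro SUP_upper) auto
    finally show ?thesis .
  qed
  from Paley_Wiener[OF hol M(2) this] obtain F where F: "F \<in> borel_measurable borel" "causal F"
    "energy (weighted c F) < \<infinity>" "\<forall>z\<in>half_plane c. laplace F z = h z" by auto
  then have "F \<in> members (L2_weighted c)"
    unfolding member_iff_representative using represents_self by auto
  with F(4) show ?thesis by auto
qed

text \<open>
  By injectivity any choice of preimages is linear up to equality almost everywhere, and the norm
  identity bounds it.
\<close>

theorem invertible_laplace: "invertible_bounded_operator (L2_weighted c) (Hardy2 c) laplace"
proof -
  let ?V = "members (L2_weighted c)" and ?W = "members (Hardy2 c)"
  define S where "S h = (SOME f. f \<in> ?V \<and> (\<forall>z\<in>half_plane c. laplace f z = h z))" for h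
  have S: "S h \<in> ?V \<and> (\<forall>z\<in>half_plane c. laplace (S h) z = h z)"
    if "f \<in> ?V" "\<And>z. z \<in> half_plane c \<Longrightarrow> laplace f z = h z" for f h
    unfolding S_def by (rule someI[of _ f]) (use that in auto)
  have SW: "S h \<in> ?V" "\<And>z. z \<in> half_plane c \<Longrightarrow> laplace (S h) z = h z" if "h \<in> ?W" for h
    using laplace_surjective_on_members[OF that] S by metis+
  have same_V: "same (L2_weighted c) (S h) f"
    if "f \<in> ?V" "\<And>z. z \<in> half_plane c \<Longrightarrow> laplace f z = h z" for f h
    using S[OF that] that by (intro laplace_injective_on_members) auto
  have same_W: "same (Hardy2 c) g h \<longleftrightarrow> (\<forall>z\<in>half_plane c. g z = h z)" for g h
    by (simp add: Hardy2_def)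
  have fnorm_cong: "fnorm (Hardy2 c) g = fnorm (Hardy2 c) h" if "\<And>z. z \<in> half_plane c \<Longrightarrow> g z = h z" for g h
  proof -
    have "Hardy_sqnorm c g = Hardy_sqnorm c h"
      unfolding Hardy_sqnorm_def using that by (intro SUP_cong refl) (auto simp: half_plane_def)
    then show ?thesis by (simp add: Hardy2_def)
  qed
  have "bounded_operator (L2_weighted c) (Hardy2 c) laplace"
    unfolding bounded_operator_def same_W
  proof (intro conjI ballI allI impI)
    show "\<exists>K. \<forall>f\<in>?V. fnorm (Hardy2 c) (laplace f) \<le> K * fnorm (L2_weighted c) f"
      using fnorm_laplace by (metis order_refl)
  qed (auto simp: laplace_member laplace_add laplace_cmult dest: laplace_cong)
  moreover have "bounded_operator (Hardy2 c) (L2_weighted c) S"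
    unfolding bounded_operator_def same_W
  proof (intro conjI ballI allI impI)
    show "\<exists>K. \<forall>h\<in>?W. fnorm (L2_weighted c) (S h) \<le> K * fnorm (Hardy2 c) h"
    proof (intro exI ballI)
      fix h assume h: "h \<in> ?W"
      have "fnorm (Hardy2 c) h = sqrt (2 * pi) * fnorm (L2_weighted c) (S h)"
        using fnorm_laplace[OF SW(1)[OF h]] fnorm_cong[of "laplace (S h)" h] SW(2)[OF h] by simp
      then show "fnorm (L2_weighted c) (S h) \<le> (1 / sqrt (2 * pi)) * fnorm (Hardy2 c) h" by simp
    qed
    show "S h \<in> ?V" if "h \<in> ?W" for h using SW(1)[OF that] .
    show "same (L2_weighted c) (S g) (S h)" if "g \<in> ?W" "h \<in> ?W" "\<forall>z\<in>half_plane c. g z = h z" for g h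
      using that SW[of h] by (intro same_V) auto
    show "same (L2_weighted c) (S (\<lambda>z. g z + h z)) (\<lambda>x. S g x + S h x)" if "g \<in> ?W" "h \<in> ?W" for g h
      using SW[OF that(1)] SW[OF that(2)] by (intro same_V members_add) (auto simp: laplace_add)
    show "same (L2_weighted c) (S (\<lambda>z. a * h z)) (\<lambda>x. a * S h x)" if "h \<in> ?W" for a h
      using SW[OF that] by (intro same_V members_cmult) (auto simp: laplace_cmult)
  qed
  moreover have "\<forall>f\<in>?V. same (L2_weighted c) (S (laplace f)) f"
    by (intro ballI same_V) auto
  moreover have "\<forall>h\<in>?W. same (Hardy2 c) (laplace (S h)) h"
    by (auto simp: same_W SW)
  ultimately show ?thesis unfolding invertible_bounded_operator_def by blast
qed

lemma truncated_fourier: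
  assumes "represents F f"
  shows "(LINT \<tau>|lebesgue_on {0<..<R}. exp (- \<i> * complex_of_real t * complex_of_real \<tau>) * weighted c f \<tau>)
       = fourier (cutoff R (weighted c F)) t"
proof -
  have [measurable]: "F \<in> borel_measurable borel" and F0: "causal F"
    and f: "f \<in> borel_measurable (lebesgue_on {0<..})" and ae: "AE x in lebesgue_on {0<..}. f x = F x"
    using assms by (auto simp: represents_def)
  have "f \<in> borel_measurable (lebesgue_on {0<..<R})"
    by (rule measurable_restrict_mono[OF f]) auto
  then have prod: "(\<lambda>\<tau>. (exp (- \<i> * complex_of_real t * complex_of_real \<tau>) * complex_of_real (exp (- c * \<tau>))) * f \<tau>)
      \<in> borel_measurable (lebesgue_on {0<..<R})"
    by (intro borel_measurable_times[OF borel_measurable_continuous_lebesgue_on] continuous_intros)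
  have m: "(\<lambda>\<tau>. exp (- \<i> * complex_of_real t * complex_of_real \<tau>) * weighted c f \<tau>) \<in> borel_measurable (lebesgue_on {0<..<R})"
    using prod by (simp add: weighted_def mult.assoc)
  have "AE x in lebesgue. x \<in> {0<..} \<longrightarrow> f x = F x"
    using ae by (subst (asm) AE_restrict_space_iff) auto
  then have "AE x in lebesgue. x \<in> {0<..<R} \<longrightarrow> f x = F x" by eventually_elim auto
  then have "AE x in lebesgue_on {0<..<R}. f x = F x"
    by (subst AE_restrict_space_iff) auto
  then have "AE \<tau> in lebesgue_on {0<..<R}. exp (- \<i> * complex_of_real t * complex_of_real \<tau>) * weighted c f \<tau>
     = exp (- \<i> * complex_of_real t * complex_of_real \<tau>) * cutoff R (weighted c F) \<tau>"
    using AE_space[of "lebesgue_on {0<..<R}"]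
    by eventually_elim (auto simp: cutoff_def weighted_def)
  then show ?thesis
    unfolding fourier_def
    by (rule integral_lebesgue_on_eq_lborel[OF _ _ _ m, rotated -1])
       (auto simp: cutoff_def weighted_def causalD[OF F0] indicator_def not_less)
qed

lemma Plancherel_transform_exists:
  assumes "f \<in> members (L2_weighted c)"
  shows "\<exists>g. is_Plancherel_transform (weighted c f) g"
proof -
  obtain F where F: "F \<in> borel_measurable borel" "causal F" "energy (weighted c F) < \<infinity>" "represents F f"
    using assms by (rule representative)
  have [measurable]: "weighted c F \<in> borel_measurable borel" using F(1) by simp
  obtain g where [measurable]: "g \<in> borel_measurable borel"
    and lim: "((\<lambda>R. energy (\<lambda>t. g t - fourier (cutoff R (weighted c F)) t)) \<longlongrightarrow> 0) at_top"
    using plancherel_L2_exists[OF _ F(3)] by auto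
  have eg: "energy g = ennreal (2 * pi) * energy (weighted c F)"
    by (rule plancherel_L2_isometry[OF _ F(3) _ lim]) auto
  have "g \<in> borel_measurable (lebesgue_on UNIV)"
    by (intro measurable_restrict_space1 measurable_completion) simp
  moreover have "energy g < \<infinity>" using F(3) by (simp add: eg ennreal_mult_less_top)
  ultimately show ?thesis
    using lim unfolding is_Plancherel_transform_def truncated_fourier[OF F(4)]
    by (intro exI[of _ g]) (simp add: L2_def L2_sqnorm_UNIV)
qed

text \<open>
  A Plancherel transform is only Lebesgue measurable, so the isometry is applied to a Borel
  representative of it.
\<close>

lemma L2_sqnorm_Plancherel_transform:
  assumes f: "f \<in> members (L2_weighted c)" and g: "is_Plancherel_transform (weighted c f) g"
  shows "L2_sqnorm UNIV g = ennreal (2 * pi) * L2_sqnorm {0<..} (weighted c f)"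
proof -
  obtain F where F: "F \<in> borel_measurable borel" "causal F" "energy (weighted c F) < \<infinity>" "represents F f"
    using f by (rule representative)
  have [measurable]: "weighted c F \<in> borel_measurable borel" using F(1) by simp
  have gL2: "g \<in> borel_measurable (lebesgue_on UNIV)"
    and glim: "((\<lambda>R. L2_sqnorm UNIV (\<lambda>t. g t - fourier (cutoff R (weighted c F)) t)) \<longlongrightarrow> 0) at_top"
    using g unfolding is_Plancherel_transform_def truncated_fourier[OF F(4)] by (auto simp: L2_def)
  obtain g' where [measurable]: "g' \<in> borel_measurable borel" and ae: "AE x in lebesgue_on UNIV. g x = g' x"
    using borel_representative[OF _ gL2] by auto
  have glim': "((\<lambda>R. energy (\<lambda>t. g' t - fourier (cutoff R (weighted c F)) t)) \<longlongrightarrow> 0) at_top"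
  proof -
    have "L2_sqnorm UNIV (\<lambda>t. g t - fourier (cutoff R (weighted c F)) t)
        = energy (\<lambda>t. g' t - fourier (cutoff R (weighted c F)) t)" for R
      using ae by (intro L2_sqnorm_eq_energy) (auto elim: eventually_mono)
    then show ?thesis using glim by simp
  qed
  have "L2_sqnorm UNIV g = energy g'"
    using ae by (intro L2_sqnorm_eq_energy) auto
  also have "\<dots> = ennreal (2 * pi) * energy (weighted c F)"
    by (rule plancherel_L2_isometry[OF _ F(3) _ glim']) auto
  finally show ?thesis by (simp add: L2_sqnorm_weighted[OF F(4)])
qed

lemma plancherel_laplace_line:
  assumes f: "f \<in> members (L2_weighted c)" and s: "s \<ge> c"
  shows "ennreal (1 / (2 * pi)) * (\<integral>\<^sup>+ t. ennreal ((cmod (laplace_line c f s t))\<^sup>2) \<partial>lebesgue)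
       = (\<integral>\<^sup>+ \<tau>. ennreal (exp (- 2 * s * \<tau>) * (cmod (f \<tau>))\<^sup>2) \<partial>lebesgue_on {0<..})"
proof -
  obtain F where F: "F \<in> borel_measurable borel" "causal F" "energy (weighted c F) < \<infinity>" "represents F f"
    using f by (rule representative)
  have "(\<integral>\<^sup>+ t. ennreal ((cmod (laplace_line c f s t))\<^sup>2) \<partial>lebesgue) = L2_sqnorm UNIV (laplace_line c f s)"
    by (simp add: L2_sqnorm_def lebesgue_on_UNIV_eq)
  also have "\<dots> = ennreal (2 * pi) * L2_sqnorm {0<..} (weighted s f)"
  proof (cases "s = c")
    case True
    have "is_Plancherel_transform (weighted c f) (Plancherel_transform (weighted c f))"
      unfolding Plancherel_transform_def using Plancherel_transform_exists[OF f] by (rule someI_ex)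
    then show ?thesis
      using True L2_sqnorm_Plancherel_transform[OF f] by (simp add: laplace_line_def)
  next
    case False
    then have s: "c < s" using s by simp
    have "(\<lambda>t. laplace F (Complex s t)) \<in> borel_measurable borel"
      using F(1) by (simp add: laplace_borel[OF F(1,2)])
    then show ?thesis
      using False energy_laplace_line[OF F(1-3) s]
      by (simp add: laplace_line_def laplace_represents[OF F(4)] L2_sqnorm_UNIV L2_sqnorm_weighted[OF F(4)])
  qed
  also have "L2_sqnorm {0<..} (weighted s f)
      = (\<integral>\<^sup>+ \<tau>. ennreal (exp (- 2 * s * \<tau>) * (cmod (f \<tau>))\<^sup>2) \<partial>lebesgue_on {0<..})"
    unfolding L2_sqnorm_def
    by (intro nn_integral_cong)
       (simp add: weighted_def norm_mult power_mult_distrib flip: exp_double)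
  finally show ?thesis
    by (simp add: mult.assoc[symmetric] ennreal_mult[symmetric])
qed

theorem proposition2p1:
  fixes c :: real
  assumes "c \<ge> 0"
  shows "(\<forall>f\<in>members (L2_weighted c). \<forall>z\<in>half_plane c.
            integrable (lebesgue_on {0<..}) (\<lambda>\<tau>. exp (- z * complex_of_real \<tau>) * f \<tau>))
       \<and> (\<forall>f\<in>members (L2_weighted c). \<exists>g. is_Plancherel_transform (weighted c f) g)
       \<and> invertible_bounded_operator (L2_weighted c) (Hardy2 c) laplace
       \<and> (\<forall>f\<in>members (L2_weighted c). \<forall>s\<ge>c.
            ennreal (1 / (2 * pi)) *
              (\<integral>\<^sup>+ t. ennreal ((cmod (laplace_line c f s t))\<^sup>2) \<partial>lebesgue)
            = (\<integral>\<^sup>+ \<tau>. ennreal (exp (- 2 * s * \<tau>) * (cmod (f \<tau>))\<^sup>2) \<partial>lebesgue_on {0<..}))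
       \<and> (\<forall>f\<in>members (L2_weighted c).
            fnorm (Hardy2 c) (laplace f) = sqrt (2 * pi) * fnorm (L2_weighted c) f)"
  using laplace_integrable Plancherel_transform_exists invertible_laplace plancherel_laplace_line fnorm_laplace
  by (intro conjI ballI allI impI)

end
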